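(* Let $C$ be any bivariate copula with $\mu_\infty(C)=m$. Then $\tau(C)\in[4m^2-1,\,1-8m^2]$, and any value from this interval can be attained (i.e. for every $m\in[0,\frac13]$ and every $t\in[4m^2-1,1-8m^2]$ there is a copula $C$ with $\mu_\infty(C)=m$ and $\tau(C)=t$). In particular, if $C$ is symmetric (i.e. $C(u,v)=C(v,u)$ for all $u,v$), then $\tau(C)$ can take any value in $[-1,1]$; and if $C$ takes the maximal possible asymmetry $\mu_\infty(C)=\frac13$, then $\tau(C)\in[-\frac59,\frac19]$.
   Context: For a bivariate copula $C$, the measure of asymmetry is $\mu_\infty(C)=\max_{u,v\in[0,1]}|C(u,v)-C(v,u)|$; its range over all copulas is $[0,\frac13]$. For copulas $C_1,C_2$ the concordance function is $\mathcal{Q}(C_1,C_2)=4\int_{[0,1]^2}C_2(u,v)\,dC_1(u,v)-1$. Kendall's tau is $\tau(C)=\mathcal{Q}(C,C)$. *)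

theory Defs
  imports "HOL-Probability.Probability"
begin

text \<open>Copulas are functions on the unit square. They are represented by total functions
  on the reals, whose values off the unit square are unconstrained and never used.\<close>

definition copula :: "(real \<Rightarrow> real \<Rightarrow> real) \<Rightarrow> bool" where
  "copula C \<longleftrightarrow>
     (\<forall>u\<in>{0..1}. C u 0 = 0 \<and> C 0 u = 0) \<and>
     (\<forall>u\<in>{0..1}. C u 1 = u \<and> C 1 u = u) \<and>
     (\<forall>u\<in>{0..1}. \<forall>u'\<in>{0..1}. \<forall>v\<in>{0..1}. \<forall>v'\<in>{0..1}. u \<le> u' \<longrightarrow> v \<le> v' \<longrightarrow>
        C u' v' - C u' v - C u v' + C u v \<ge> 0)"

definition symmetric_copula :: "(real \<Rightarrow> real \<Rightarrow> real) \<Rightarrow> bool" where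
  "symmetric_copula C \<longleftrightarrow> copula C \<and> (\<forall>u\<in>{0..1}. \<forall>v\<in>{0..1}. C u v = C v u)"

text \<open>The supremum is attained because copulas are continuous; see
  \<open>asymmetry_attained\<close> below.\<close>

definition asymmetry :: "(real \<Rightarrow> real \<Rightarrow> real) \<Rightarrow> real" where
  "asymmetry C = (SUP (u, v)\<in>{0..1} \<times> {0..1}. \<bar>C u v - C v u\<bar>)"

text \<open>The measure \<open>dC\<close> is the unique Borel probability measure whose distribution function
  on the unit square is \<open>C\<close>. As \<open>C 1 1 = 1\<close>, it is concentrated on the unit square.\<close>

definition copula_measure :: "(real \<Rightarrow> real \<Rightarrow> real) \<Rightarrow> (real \<times> real) measure" where
  "copula_measure C =
     (THE M. prob_space M \<and> sets M = sets borel \<and>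
        (\<forall>u\<in>{0..1}. \<forall>v\<in>{0..1}. measure M ({0..u} \<times> {0..v}) = C u v))"

definition concordance ::
    "(real \<Rightarrow> real \<Rightarrow> real) \<Rightarrow> (real \<Rightarrow> real \<Rightarrow> real) \<Rightarrow> real" where
  "concordance C1 C2 =
     4 * (LINT p:{0..1} \<times> {0..1}|copula_measure C1. C2 (fst p) (snd p)) - 1"

definition kendall_tau :: "(real \<Rightarrow> real \<Rightarrow> real) \<Rightarrow> real" where
  "kendall_tau C = concordance C C"

lemma copula_mono_lipschitz:
  assumes C: "copula C" and u: "0 \<le> u" "u \<le> u'" "u' \<le> 1" and v: "0 \<le> v" "v \<le> 1"
  shows "0 \<le> C u' v - C u v" "C u' v - C u v \<le> u' - u"
    and "0 \<le> C v u' - C v u" "C v u' - C v u \<le> u' - u"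
proof -
  have inc: "C b d - C b c - C a d + C a c \<ge> 0"
    if "0 \<le> a" "a \<le> b" "b \<le> 1" "0 \<le> c" "c \<le> d" "d \<le> 1" for a b c d
    using C that unfolding copula_def by force
  have marg: "C x 0 = 0" "C 0 x = 0" "C x 1 = x" "C 1 x = x" if "0 \<le> x" "x \<le> 1" for x
    using C that unfolding copula_def by auto
  show "0 \<le> C u' v - C u v" "C u' v - C u v \<le> u' - u"
    using inc[of u u' 0 v] inc[of u u' v 1] marg[of u] marg[of u'] u v by auto
  show "0 \<le> C v u' - C v u" "C v u' - C v u \<le> u' - u"
    using inc[of 0 v u u'] inc[of v 1 u u'] marg[of u] marg[of u'] u v by auto
qed

lemma copula_lipschitz:
  assumes C: "copula C"
    and "u \<in> {0..1}" "u' \<in> {0..1}" "v \<in> {0..1}" "v' \<in> {0..1}"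
  shows "\<bar>C u v - C u' v'\<bar> \<le> \<bar>u - u'\<bar> + \<bar>v - v'\<bar>"
proof -
  have "\<bar>C u v - C u' v\<bar> \<le> \<bar>u - u'\<bar>"
    using copula_mono_lipschitz(1,2)[OF C, of u u' v]
      copula_mono_lipschitz(1,2)[OF C, of u' u v] assms by (cases "u \<le> u'") auto
  moreover have "\<bar>C u' v - C u' v'\<bar> \<le> \<bar>v - v'\<bar>"
    using copula_mono_lipschitz(3,4)[OF C, of v v' u']
      copula_mono_lipschitz(3,4)[OF C, of v' v u'] assms by (cases "v \<le> v'") auto
  ultimately show ?thesis by linarith
qed

lemma continuous_on_copula:
  assumes C: "copula C"
  shows "continuous_on ({0..1} \<times> {0..1}) (\<lambda>p. C (fst p) (snd p))"
proof (unfold continuous_on_iff, intro ballI allI impI)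
  fix p :: "real \<times> real" and e :: real
  assume p: "p \<in> {0..1} \<times> {0..1}" and e: "e > 0"
  have "dist (C (fst q) (snd q)) (C (fst p) (snd p)) < e"
    if q: "q \<in> {0..1} \<times> {0..1}" and d: "dist q p < e / 2" for q
  proof -
    have "dist (C (fst q) (snd q)) (C (fst p) (snd p))
        \<le> \<bar>fst q - fst p\<bar> + \<bar>snd q - snd p\<bar>"
      unfolding dist_real_def using copula_lipschitz[OF C] p q by auto
    moreover have "\<bar>fst q - fst p\<bar> \<le> dist q p" "\<bar>snd q - snd p\<bar> \<le> dist q p"
      using dist_fst_le[of q p] dist_snd_le[of q p] by (auto simp: dist_real_def)
    ultimately show ?thesis using d by linarith
  qed
  then show "\<exists>d>0. \<forall>q\<in>{0..1} \<times> {0..1}. dist q p < d \<longrightarrow>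
      dist (C (fst q) (snd q)) (C (fst p) (snd p)) < e"
    using e by (intro exI[of _ "e / 2"]) auto
qed

lemma asymmetry_attained:
  assumes C: "copula C"
  shows "\<exists>u\<in>{0..1}. \<exists>v\<in>{0..1}. asymmetry C = \<bar>C u v - C v u\<bar> \<and>
           (\<forall>u'\<in>{0..1}. \<forall>v'\<in>{0..1}. \<bar>C u' v' - C v' u'\<bar> \<le> \<bar>C u v - C v u\<bar>)"
proof -
  let ?S = "{0..1} \<times> {0..1} :: (real \<times> real) set"
  let ?f = "\<lambda>p. \<bar>C (fst p) (snd p) - C (snd p) (fst p)\<bar>"
  have c: "continuous_on ?S (\<lambda>p. C (fst p) (snd p))"
    by (rule continuous_on_copula[OF C])
  have "continuous_on ?S (\<lambda>p. (\<lambda>q. C (fst q) (snd q)) (snd p, fst p))"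
    by (rule continuous_on_compose2[OF c]) (auto intro!: continuous_intros)
  then have "continuous_on ?S ?f"
    using c by (auto intro!: continuous_intros)
  moreover have "compact ?S" "?S \<noteq> {}"
    by (auto intro: compact_Times)
  ultimately have "\<exists>p\<in>?S. \<forall>q\<in>?S. ?f q \<le> ?f p"
    by (intro continuous_attains_sup)
  then obtain p where p: "p \<in> ?S" and max: "\<And>q. q \<in> ?S \<Longrightarrow> ?f q \<le> ?f p"
    by blast
  have "asymmetry C = (SUP q\<in>?S. ?f q)"
    by (simp add: asymmetry_def case_prod_beta)
  also have "\<dots> = ?f p"
    using p max by (intro cSup_eq_maximum imageI) blast+
  finally have eq: "asymmetry C = ?f p" .
  have "\<forall>u'\<in>{0..1}. \<forall>v'\<in>{0..1}. \<bar>C u' v' - C v' u'\<bar> \<le> ?f p"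
    using max[OF SigmaI] by simp
  moreover have "fst p \<in> {0..1}" "snd p \<in> {0..1}"
    using p by (simp_all add: mem_Times_iff)
  ultimately show ?thesis
    using eq by blast
qed

end

theory Submission
  imports Defs
begin

text \<open>Let \<open>a \<le> b\<close> with \<open>\<bar>C a b - C b a\<bar> = m\<close>. In the 3 by 3 grid with lines at \<open>a\<close> and \<open>b\<close>, the uniform
  margins force mass at least \<open>m\<close> into three cells in cyclic position. Two of them are concordant
  with each other, and both are discordant with the third, so that two independent points of law \<open>dC\<close>
  are concordant with probability at least \<open>2 m\<^sup>2\<close> and discordant with probability at least \<open>4 m\<^sup>2\<close>.
  Copulas carried by graphs of piecewise isometries attain both bounds, and the
  values in between come from convex combinations of copulas that attain their asymmetry at a
  common point, along which Kendall's tau is continuous.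
  The measure \<open>dC\<close> is the image of Lebesgue measure on \<open>[0, 1)\<close> under the map that sends nested
  intervals, of the lengths prescribed by \<open>C\<close>, to the nested dyadic cells of the square.\<close>

section \<open>The law of a copula\<close>

definition unit_clip :: "real \<Rightarrow> real" where
  "unit_clip x = max 0 (min 1 x)"

text \<open>Values of a copula off the unit square are arbitrary. Clamping the arguments gives a
  continuous bounded function on the whole plane, which is the distribution function of dC.\<close>

definition copula_ext :: "(real \<Rightarrow> real \<Rightarrow> real) \<Rightarrow> real \<times> real \<Rightarrow> real" where
  "copula_ext C p = C (unit_clip (fst p)) (unit_clip (snd p))"

text \<open>The property under the description operator in \<open>copula_measure\<close>, for an
  arbitrary candidate measure, so that any concrete law can be used for computation once uniqueness
  is known.\<close>

definition copula_law :: "(real \<Rightarrow> real \<Rightarrow> real) \<Rightarrow> (real \<times> real) measure \<Rightarrow> bool" where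
  "copula_law C M \<longleftrightarrow> prob_space M \<and> sets M = sets borel \<and>
     (\<forall>u\<in>{0..1}. \<forall>v\<in>{0..1}. measure M ({0..u} \<times> {0..v}) = C u v)"

lemma unit_clip_range [simp]: "0 \<le> unit_clip x" "unit_clip x \<le> 1" "unit_clip x \<in> {0..1}"
  by (auto simp: unit_clip_def)

lemma unit_clip_id [simp]: "0 \<le> x \<Longrightarrow> x \<le> 1 \<Longrightarrow> unit_clip x = x"
  by (simp add: unit_clip_def)

lemma unit_clip_mono: "x \<le> y \<Longrightarrow> unit_clip x \<le> unit_clip y"
  by (auto simp: unit_clip_def)

lemma unit_clip_lipschitz: "\<bar>unit_clip x - unit_clip y\<bar> \<le> \<bar>x - y\<bar>"
  by (auto simp: unit_clip_def)

lemma copula_margins: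
  assumes "copula C" "0 \<le> u" "u \<le> 1"
  shows "C u 0 = 0" "C 0 u = 0" "C u 1 = u" "C 1 u = u"
  using assms unfolding copula_def by auto

lemma copula_increasing:
  assumes "copula C" "0 \<le> a" "a \<le> b" "b \<le> 1" "0 \<le> c" "c \<le> d" "d \<le> 1"
  shows "C b d - C b c - C a d + C a c \<ge> 0"
  using assms unfolding copula_def by force

lemma copula_bounds:
  assumes C: "copula C" and u: "0 \<le> u" "u \<le> 1" and v: "0 \<le> v" "v \<le> 1"
  shows "0 \<le> C u v" "C u v \<le> u" "C u v \<le> v" "u + v - 1 \<le> C u v"
  using copula_increasing[OF C, of 0 u 0 v] copula_increasing[OF C, of 0 u v 1]
    copula_increasing[OF C, of u 1 0 v] copula_increasing[OF C, of u 1 v 1]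
    copula_margins[OF C] u v by auto

lemma copula_ext_eq [simp]:
  "0 \<le> u \<Longrightarrow> u \<le> 1 \<Longrightarrow> 0 \<le> v \<Longrightarrow> v \<le> 1 \<Longrightarrow> copula_ext C (u, v) = C u v"
  by (simp add: copula_ext_def)

lemma measurable_copula_ext:
  assumes C: "copula C"
  shows "copula_ext C \<in> borel_measurable borel"
proof (rule borel_measurable_continuous_onI)
  have "continuous_on UNIV
      (\<lambda>p. (\<lambda>q. C (fst q) (snd q)) (unit_clip (fst p), unit_clip (snd p)))"
    by (rule continuous_on_compose2[OF continuous_on_copula[OF C]])
      (auto intro!: continuous_intros simp: unit_clip_def)
  then show "continuous_on UNIV (copula_ext C)"
    by (simp add: copula_ext_def)
qed

lemma copula_ext_bounded:
  assumes "copula C"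
  shows "0 \<le> copula_ext C p" "copula_ext C p \<le> 1"
  using copula_bounds(1,2)[OF assms unit_clip_range(1,2) unit_clip_range(1,2), of "fst p" "snd p"]
    unit_clip_range(2)[of "fst p"]
  unfolding copula_ext_def by linarith+

lemma copula_law_square:
  assumes L: "copula_law C M" and C: "copula C"
  shows "AE p in M. p \<in> {0..1} \<times> {0..1}"
proof -
  interpret prob_space M using L by (simp add: copula_law_def)
  have sets: "sets M = sets borel" using L by (simp add: copula_law_def)
  have "prob ({0..1} \<times> {0..1}) = 1"
    using L copula_margins[OF C, of 1] by (simp add: copula_law_def)
  then show ?thesis
    by (intro AE_prob_1) auto
qed

text \<open>Almost every point lies in the unit square, so the quadrant and the clamped rectangle
  agree up to a null set. If a coordinate of \<open>p\<close> is negative, the quadrant is null and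
  the clamped value vanishes.\<close>

lemma copula_law_atMost:
  assumes L: "copula_law C M" and C: "copula C"
  shows "measure M {..p} = copula_ext C p"
proof -
  interpret prob_space M using L by (simp add: copula_law_def)
  have sets [measurable_cong]: "sets M = sets borel" using L by (simp add: copula_law_def)
  obtain u v where p: "p = (u, v)" by fastforce
  let ?Q = "{0..unit_clip u} \<times> {0..unit_clip v}"
  have eq: "prob ?Q = copula_ext C p"
    using L by (simp add: copula_law_def copula_ext_def p)
  show ?thesis
  proof (cases "0 \<le> u \<and> 0 \<le> v")
    case True
    have "prob {..p} = prob ?Q"
      using copula_law_square[OF L C] True
      by (intro finite_measure_eq_AE) (auto simp: sets p unit_clip_def borel_closed closed_Times)
    then show ?thesis using eq by simp
  next
    case False
    have "prob {..p} = prob {}"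
      using copula_law_square[OF L C] False
      by (intro finite_measure_eq_AE) (auto simp: sets p unit_clip_def borel_closed)
    moreover have "copula_ext C p = 0"
    proof -
      have "unit_clip u = 0 \<or> unit_clip v = 0"
        using False by (auto simp: unit_clip_def)
      then show ?thesis
        using copula_margins(1,2)[OF C unit_clip_range(1,2)] by (auto simp: copula_ext_def p)
    qed
    ultimately show ?thesis by simp
  qed
qed

text \<open>Lower quadrants form an intersection-stable generator of the Borel sets, and
  \<open>copula_law_atMost\<close> determines the measure of each from \<open>C\<close>
  alone.\<close>

lemma copula_law_unique:
  assumes M: "copula_law C M" and N: "copula_law C N" and C: "copula C"
  shows "M = N"
proof -
  interpret M: prob_space M using M by (simp add: copula_law_def)
  interpret N: prob_space N using N by (simp add: copula_law_def)
  let ?E = "range (\<lambda>p. {..p}) :: (real \<times> real) set set"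
  have borel: "sets borel = sigma_sets UNIV ?E"
    by (subst borel_eq_atMost) (simp add: sets_measure_of)
  show ?thesis
  proof (rule measure_eqI_generator_eq[of ?E UNIV M N "\<lambda>n. {..(real n, real n)}"])
    show "Int_stable ?E"
      unfolding Int_stable_def
    proof safe
      fix a b c d :: real
      have "{..(a, b)} \<inter> {..(c, d)} = {..(min a c, min b d)}"
        by auto
      then show "{..(a, b)} \<inter> {..(c, d)} \<in> ?E" by blast
    qed
    show "emeasure M X = emeasure N X" if "X \<in> ?E" for X
      using that copula_law_atMost[OF M C] copula_law_atMost[OF N C]
      by (auto simp: M.emeasure_eq_measure N.emeasure_eq_measure)
    show "(\<Union>n. {..(real n, real n)}) = UNIV"
    proof -
      have "p \<in> (\<Union>n. {..(real n, real n)})" for p :: "real \<times> real"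
      proof -
        obtain n where "max (fst p) (snd p) \<le> real n" using real_arch_simple by blast
        then show ?thesis by (cases p) auto
      qed
      then show ?thesis by blast
    qed
  qed (use M N borel in \<open>auto simp: copula_law_def\<close>)
qed

lemma copula_measure_eq:
  assumes "copula_law C M" "copula C"
  shows "copula_measure C = M"
  unfolding copula_measure_def copula_law_def[symmetric]
  using assms copula_law_unique by blast

lemma integrable_copula_ext:
  assumes M: "prob_space M" "sets M = sets borel" and C: "copula C"
  shows "integrable M (copula_ext C)"
proof -
  interpret prob_space M by (rule M)
  show ?thesis
    using copula_ext_bounded[OF C] measurable_copula_ext[OF C]
    by (intro integrable_const_bound[of _ 1]) (auto simp: measurable_cong_sets[OF M(2) refl])
qed

lemma kendall_tau_eq:
  assumes L: "copula_law C M" and C: "copula C"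
  shows "kendall_tau C = 4 * (\<integral>p. copula_ext C p \<partial>M) - 1"
proof -
  have sets [measurable_cong]: "sets M = sets borel" using L by (simp add: copula_law_def)
  have [measurable]: "{0..1} \<times> {0..1} \<in> sets M"
    by (simp add: sets borel_closed closed_Times)
  have [measurable]: "copula_ext C \<in> borel_measurable M"
    using measurable_copula_ext[OF C] by (simp add: measurable_cong_sets[OF sets refl])
  have "(LINT p:{0..1} \<times> {0..1}|M. C (fst p) (snd p)) =
      (\<integral>p. indicator ({0..1} \<times> {0..1}) p *\<^sub>R copula_ext C p \<partial>M)"
    unfolding set_lebesgue_integral_def
    by (intro Bochner_Integration.integral_cong)
      (auto simp: copula_ext_def split: split_indicator)
  also have "\<dots> = (\<integral>p. copula_ext C p \<partial>M)"
    using copula_law_square[OF L C]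
    by (intro integral_cong_AE) auto
  finally show ?thesis
    by (simp add: kendall_tau_def concordance_def copula_measure_eq[OF L C])
qed

lemma copula_law_cell:
  assumes L: "copula_law C M" and C: "copula C"
    and "0 \<le> a" "a \<le> b" "b \<le> 1" "0 \<le> c" "c \<le> d" "d \<le> 1"
  shows "measure M ({a<..b} \<times> {c<..d}) = C b d - C b c - C a d + C a c"
proof -
  interpret prob_space M using L by (simp add: copula_law_def)
  have sets: "sets M = sets borel" using L by (simp add: copula_law_def)
  have [simp]: "{..p} \<in> sets M" for p :: "real \<times> real" by (simp add: sets)
  have at: "prob {..(u, v)} = C u v" if "0 \<le> u" "u \<le> 1" "0 \<le> v" "v \<le> 1" for u v
    using copula_law_atMost[OF L C] that by simp
  \<comment> \<open>Every difference removes a subset, as subtractivity of a finite measure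
    requires.\<close>
  have cell: "{a<..b} \<times> {c<..d} = ({..(b, d)} - {..(b, c)}) - ({..(a, d)} - {..(a, c)})"
    using assms by (auto simp: not_le)
  have "prob ({a<..b} \<times> {c<..d}) =
      prob ({..(b, d)} - {..(b, c)}) - prob ({..(a, d)} - {..(a, c)})"
    unfolding cell using assms by (intro finite_measure_Diff) auto
  also have "prob ({..(b, d)} - {..(b, c)}) = C b d - C b c"
    using assms by (subst finite_measure_Diff) (auto simp: at)
  also have "prob ({..(a, d)} - {..(a, c)}) = C a d - C a c"
    using assms by (subst finite_measure_Diff) (auto simp: at)
  finally show ?thesis by simp
qed

section \<open>The uniform distribution on the unit interval\<close>

definition unif01 :: "real measure" where
  "unif01 = density lborel (indicator {0..1})"

lemma sets_unif01 [simp, measurable_cong]: "sets unif01 = sets borel"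
  by (simp add: unif01_def)

lemma space_unif01 [simp]: "space unif01 = UNIV"
  by (simp add: unif01_def)

lemma measure_unif01:
  assumes "A \<in> sets borel"
  shows "measure unif01 A = measure lborel (A \<inter> {0..1})"
proof -
  have "emeasure unif01 A = emeasure lborel (A \<inter> {0..1})"
    using assms unfolding unif01_def
    by (subst emeasure_density) (auto simp: nn_integral_indicator[symmetric] indicator_inter_arith
        mult.commute simp del: nn_integral_indicator)
  then show ?thesis by (simp add: measure_def)
qed

lemma prob_space_unif01: "prob_space unif01"
proof
  have "emeasure unif01 UNIV = emeasure lborel {0..1::real}"
    unfolding unif01_def by (subst emeasure_density) auto
  then show "emeasure unif01 (space unif01) = 1" by simp
qed

lemma integral_unif01:
  fixes f :: "real \<Rightarrow> real"
  assumes "f \<in> borel_measurable borel"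
  shows "(\<integral>x. f x \<partial>unif01) = (LBINT x:{0..1}. f x)"
proof -
  have "unif01 = density lborel (\<lambda>x. ennreal (indicator {0..1} x))"
    unfolding unif01_def by (rule density_cong) (auto simp: ennreal_indicator)
  then have "(\<integral>x. f x \<partial>unif01) =
      (\<integral>x. f x \<partial>density lborel (\<lambda>x. ennreal (indicator {0..1} x)))"
    by (rule arg_cong)
  also have "\<dots> = (LBINT x:{0..1}. f x)"
    unfolding set_lebesgue_integral_def using assms by (intro integral_density) auto
  finally show ?thesis .
qed

section \<open>Existence of the law\<close>

text \<open>The increment of a distribution function over the rectangle
  \<open>{a<..b} \<times> {c<..d}\<close>. The function is a parameter because truncations of
  \<open>copula_ext C\<close> are inserted later as well.\<close>

definition rect_mass :: "(real \<times> real \<Rightarrow> real) \<Rightarrow> real \<Rightarrow> real \<Rightarrow> real \<Rightarrow> real \<Rightarrow> real" where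
  "rect_mass G a b c d = G (b, d) - G (b, c) - G (a, d) + G (a, c)"

text \<open>The cell with index \<open>k\<close> in the Z-order of the dyadic grid of level \<open>n\<close> has column \<open>zcol k\<close>
  and row \<open>zrow k\<close>, which de-interleave the binary digits of \<open>k\<close>. They do not depend on \<open>n\<close>, and
  the four quarters of cell \<open>k\<close> are the cells \<open>4 * k + r\<close> with \<open>r < 4\<close> of the next level.\<close>

fun zcol :: "nat \<Rightarrow> nat" where
  "zcol k = (if k = 0 then 0 else 2 * zcol (k div 4) + k div 2 mod 2)"

fun zrow :: "nat \<Rightarrow> nat" where
  "zrow k = (if k = 0 then 0 else 2 * zrow (k div 4) + k mod 2)"

declare zcol.simps [simp del] zrow.simps [simp del]

lemma zcol_0 [simp]: "zcol 0 = 0" and zrow_0 [simp]: "zrow 0 = 0"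
  by (simp_all add: zcol.simps zrow.simps)

lemma zcol_step:
  assumes "r < 4"
  shows "zcol (4 * k + r) = 2 * zcol k + r div 2"
proof -
  have "(4 * k + r) div 2 = 2 * k + r div 2" "r div 2 < 2"
    using assms by linarith+
  then have "(4 * k + r) div 4 = k" "(4 * k + r) div 2 mod 2 = r div 2"
    using assms by simp_all
  then show ?thesis
    by (subst zcol.simps) auto
qed

lemma zrow_step:
  assumes "r < 4"
  shows "zrow (4 * k + r) = 2 * zrow k + r mod 2"
proof -
  have "4 * k + r = 2 * (2 * k) + r"
    by simp
  then have "(4 * k + r) div 4 = k" "(4 * k + r) mod 2 = r mod 2"
    using assms by (simp, metis mod_mult_self4)
  then show ?thesis
    by (subst zrow.simps) auto
qed

lemma zcol_child: "2 * zcol (k div 4) \<le> zcol k" "zcol k \<le> 2 * zcol (k div 4) + 1"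
  and zrow_child: "2 * zrow (k div 4) \<le> zrow k" "zrow k \<le> 2 * zrow (k div 4) + 1"
proof -
  have "zcol k = 2 * zcol (k div 4) + k mod 4 div 2" "zrow k = 2 * zrow (k div 4) + k mod 4 mod 2"
    using zcol_step[of "k mod 4" "k div 4"] zrow_step[of "k mod 4" "k div 4"] by simp_all
  moreover have "k mod 4 div 2 \<le> 1" "k mod 4 mod 2 \<le> 1"
    by (simp_all add: less_mult_imp_div_less less_Suc_eq_le[symmetric] del: mod_mod_cancel)
  ultimately show "2 * zcol (k div 4) \<le> zcol k" "zcol k \<le> 2 * zcol (k div 4) + 1"
    "2 * zrow (k div 4) \<le> zrow k" "zrow k \<le> 2 * zrow (k div 4) + 1"
    by auto
qed

definition zcell_mass :: "(real \<times> real \<Rightarrow> real) \<Rightarrow> nat \<Rightarrow> nat \<Rightarrow> real" where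
  "zcell_mass G n k = rect_mass G (zcol k / 2 ^ n) ((zcol k + 1) / 2 ^ n)
     (zrow k / 2 ^ n) ((zrow k + 1) / 2 ^ n)"

text \<open>The values of \<open>G\<close> at the five grid points that are not corners of the
  parent cell cancel.\<close>

lemma zcell_mass_split:
  "zcell_mass G n k = (\<Sum>r<4. zcell_mass G (Suc n) (4 * k + r))"
proof -
  have half: "(2 * x) / (2 * 2 ^ n) = x / 2 ^ n" "(2 * x + 1 + 1) / (2 * 2 ^ n) = (x + 1) / 2 ^ n"
    "(2 * x + 2) / (2 * 2 ^ n) = (x + 1) / 2 ^ n" "(2 + 2 * x) / (2 * 2 ^ n) = (1 + x) / 2 ^ n"
    for x :: real
    by (simp_all add: field_simps)
  have sum4: "(\<Sum>r<4. h r) = h 0 + h 1 + h 2 + h 3" for h :: "nat \<Rightarrow> real"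
    by (simp add: numeral_eq_Suc)
  have steps: "zcol (4 * k + 0) = 2 * zcol k" "zcol (4 * k + 1) = 2 * zcol k"
    "zcol (4 * k + 2) = 2 * zcol k + 1" "zcol (4 * k + 3) = 2 * zcol k + 1"
    "zrow (4 * k + 0) = 2 * zrow k" "zrow (4 * k + 1) = 2 * zrow k + 1"
    "zrow (4 * k + 2) = 2 * zrow k" "zrow (4 * k + 3) = 2 * zrow k + 1"
    using zcol_step[of 0 k] zcol_step[of 1 k] zcol_step[of 2 k] zcol_step[of 3 k]
      zrow_step[of 0 k] zrow_step[of 1 k] zrow_step[of 2 k] zrow_step[of 3 k] by simp_all
  show ?thesis
    unfolding sum4 zcell_mass_def rect_mass_def steps
    by (simp add: half del: mult_divide_mult_cancel_left_if)
qed

lemma sum_zcell_mass_Suc: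
  "(\<Sum>l<4 * k. zcell_mass G (Suc n) l) = (\<Sum>l<k. zcell_mass G n l)"
proof (induction k)
  case (Suc k)
  have "(\<Sum>l<4 * Suc k. zcell_mass G (Suc n) l) =
      (\<Sum>l<4 * k. zcell_mass G (Suc n) l) + (\<Sum>r<4. zcell_mass G (Suc n) (4 * k + r))"
    by (simp add: numeral_eq_Suc)
  then show ?case using Suc by (simp add: zcell_mass_split[of G n k])
qed simp

lemma sum_zcell_mass:
  "(\<Sum>l<4 ^ n. zcell_mass G n l) = rect_mass G 0 1 0 1"
proof (induction n)
  case 0
  then show ?case by (simp add: zcell_mass_def)
next
  case (Suc n)
  then show ?case using sum_zcell_mass_Suc[where k = "4 ^ n"] by simp
qed

text \<open>Left ends increase and right ends decrease, so the intervals are nested. Their lengths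
  tend to 0, and the limit of the left ends lies in all of them.\<close>

lemma nested_dyadic_limit:
  fixes a :: "nat \<Rightarrow> real"
  assumes inc: "\<And>n. a n \<le> a (Suc n)" and dec: "\<And>n. a (Suc n) + 1 / 2 ^ Suc n \<le> a n + 1 / 2 ^ n"
  shows "a n \<le> lim a" "lim a \<le> a n + 1 / 2 ^ n"
proof -
  have "incseq a" using inc by (rule incseq_SucI)
  have decs: "decseq (\<lambda>n. a n + 1 / 2 ^ n)" using dec by (rule decseq_SucI)
  have "a n \<le> a 0 + 1" for n
  proof -
    have "a n \<le> a n + 1 / 2 ^ n" by simp
    also have "\<dots> \<le> a 0 + 1"
      using decseqD[OF decs, of 0 n] by simp
    finally show ?thesis .
  qed
  then obtain L where L: "a \<longlonglongrightarrow> L" "\<forall>i. a i \<le> L"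
    using incseq_convergent[OF \<open>incseq a\<close>] by blast
  have "(\<lambda>n. a n + (1 / 2) ^ n) \<longlonglongrightarrow> L + 0"
    by (intro tendsto_add L LIMSEQ_power_zero) simp
  then have "L \<le> a n + 1 / 2 ^ n"
    using decseq_ge[OF decs, of L n] by (simp add: power_one_over)
  then show "a n \<le> lim a" "lim a \<le> a n + 1 / 2 ^ n"
    using L limI[OF L(1)] by auto
qed

lemma AE_unif01: "AE t in unif01. 0 \<le> t \<and> t < 1"
proof -
  interpret prob_space unif01 by (rule prob_space_unif01)
  have "{0..<1} \<inter> {0..1} = {0..<1::real}" by auto
  then have "prob {0..<1} = 1"
    by (simp add: measure_unif01)
  from AE_prob_1[OF this] show ?thesis by simp
qed

section \<open>The map that carries Lebesgue measure to the law of a copula\<close>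

context
  fixes C :: "real \<Rightarrow> real \<Rightarrow> real"
  assumes C: "copula C"
begin

lemma rect_mass_nonneg:
  assumes "a \<le> b" "c \<le> d"
  shows "0 \<le> rect_mass (copula_ext C) a b c d"
  unfolding rect_mass_def copula_ext_def fst_conv snd_conv
  by (intro copula_increasing[OF C] unit_clip_mono assms unit_clip_range)

lemma copula_ext_sides:
  "u \<le> 0 \<Longrightarrow> copula_ext C (u, v) = 0" "v \<le> 0 \<Longrightarrow> copula_ext C (u, v) = 0"
  using copula_margins(2)[OF C unit_clip_range(1,2)] copula_margins(1)[OF C unit_clip_range(1,2)]
  by (auto simp: copula_ext_def unit_clip_def)

lemma copula_ext_lipschitz:
  "\<bar>copula_ext C (u, v) - copula_ext C (u', v')\<bar> \<le> \<bar>u - u'\<bar> + \<bar>v - v'\<bar>"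
  using copula_lipschitz[OF C unit_clip_range(3) unit_clip_range(3) unit_clip_range(3) unit_clip_range(3),
      of u v u' v'] unit_clip_lipschitz[of u u'] unit_clip_lipschitz[of v v']
  unfolding copula_ext_def by simp

definition zmass :: "nat \<Rightarrow> nat \<Rightarrow> real" where
  "zmass n k = zcell_mass (copula_ext C) n k"

lemma zmass_nonneg: "0 \<le> zmass n k"
  unfolding zmass_def zcell_mass_def
  by (rule rect_mass_nonneg) (auto simp: divide_right_mono)

text \<open>The intervals of lengths \<open>zmass n k\<close> are laid end to end in Z-order; this
  is the left end of interval \<open>k\<close>.\<close>

definition zstart :: "nat \<Rightarrow> nat \<Rightarrow> real" where
  "zstart n k = (\<Sum>l<k. zmass n l)"

lemma zstart_mono: "j \<le> k \<Longrightarrow> zstart n j \<le> zstart n k"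
  unfolding zstart_def by (intro sum_mono2) (auto simp: zmass_nonneg)

lemma zstart_0 [simp]: "zstart n 0 = 0"
  by (simp add: zstart_def)

lemma zstart_Suc: "zstart n (Suc k) = zstart n k + zmass n k"
  by (simp add: zstart_def)

lemma zstart_full: "zstart n (4 ^ n) = 1"
  using copula_margins[OF C, of 1] copula_margins[OF C, of 0]
  by (simp add: zstart_def zmass_def sum_zcell_mass rect_mass_def)

text \<open>Z-order makes the quarters of a cell consecutive, so the partition of the next level
  refines this one.\<close>

lemma zstart_refine: "zstart (Suc n) (4 * k) = zstart n k"
  unfolding zstart_def zmass_def by (rule sum_zcell_mass_Suc)

text \<open>For \<open>t\<close> in [0, 1), taking the least index skips cells of mass 0, whose
  intervals are empty.\<close>

definition zindex :: "nat \<Rightarrow> real \<Rightarrow> nat" where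
  "zindex n t = (LEAST k. t < zstart n (Suc k))"

lemma zindex:
  assumes "0 \<le> t" "t < 1"
  shows "zstart n (zindex n t) \<le> t" "t < zstart n (Suc (zindex n t))" "zindex n t < 4 ^ n"
proof -
  have ex: "t < zstart n (Suc (4 ^ n - 1))"
    using assms zstart_full[of n] by simp
  show "t < zstart n (Suc (zindex n t))"
    unfolding zindex_def by (rule LeastI[of "\<lambda>k. t < zstart n (Suc k)", OF ex])
  have "zindex n t \<le> 4 ^ n - 1"
    unfolding zindex_def by (rule Least_le[of "\<lambda>k. t < zstart n (Suc k)", OF ex])
  then show "zindex n t < 4 ^ n"
    by (simp add: le_diff_conv2 Suc_le_eq[symmetric])
  show "zstart n (zindex n t) \<le> t"
  proof (cases "zindex n t")
    case (Suc k)
    then have "\<not> t < zstart n (Suc k)"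
      using not_less_Least[of k "\<lambda>k. t < zstart n (Suc k)"] by (simp add: zindex_def)
    then show ?thesis using Suc by simp
  qed (use assms in simp)
qed

lemma zindex_unique:
  assumes "zstart n j \<le> t" "t < zstart n (Suc j)" "zstart n k \<le> t" "t < zstart n (Suc k)"
  shows "j = k"
proof (rule ccontr)
  assume "j \<noteq> k"
  then consider "Suc j \<le> k" | "Suc k \<le> j" by linarith
  then show False
    using zstart_mono[of "Suc j" k n] zstart_mono[of "Suc k" j n] assms by cases auto
qed

lemma zindex_refine:
  assumes t: "0 \<le> t" "t < 1"
  shows "zindex (Suc n) t div 4 = zindex n t"
proof (rule zindex_unique)
  let ?k = "zindex (Suc n) t"
  show "zstart n (?k div 4) \<le> t"
    using zindex(1)[OF t, of "Suc n"] zstart_mono[of "4 * (?k div 4)" ?k "Suc n"]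
    by (simp add: zstart_refine)
  show "t < zstart n (Suc (?k div 4))"
  proof -
    \<comment> \<open>Rounding up to a multiple of 4 reaches the right end of the parent
      interval.\<close>
    have "Suc ?k \<le> 4 * Suc (?k div 4)" by presburger
    then show ?thesis
      using zindex(2)[OF t, of "Suc n"] zstart_mono[of "Suc ?k" "4 * Suc (?k div 4)" "Suc n"]
      unfolding zstart_refine by linarith
  qed
qed (use zindex[OF t] in auto)

text \<open>With \<open>z = zcol\<close> this is the left edge, and with \<open>z = zrow\<close> the
  bottom edge, of the cell of level \<open>n\<close> assigned to \<open>t\<close>.\<close>

definition zcoord :: "(nat \<Rightarrow> nat) \<Rightarrow> nat \<Rightarrow> real \<Rightarrow> real" where
  "zcoord z n t = z (zindex n t) / 2 ^ n"

lemma zcoord_limit: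
  assumes t: "0 \<le> t" "t < 1"
    and z: "\<And>k. 2 * z (k div 4) \<le> z k" "\<And>k. z k \<le> 2 * z (k div 4) + 1"
  shows "zcoord z n t \<le> lim (\<lambda>n. zcoord z n t)"
    "lim (\<lambda>n. zcoord z n t) \<le> zcoord z n t + 1 / 2 ^ n"
proof -
  have step: "zcoord z n t \<le> zcoord z (Suc n) t"
    "zcoord z (Suc n) t + 1 / 2 ^ Suc n \<le> zcoord z n t + 1 / 2 ^ n" for n
  proof -
    define k where "k = zindex (Suc n) t"
    have "2 * real (z (k div 4)) \<le> real (z k)" "real (z k) \<le> 2 * real (z (k div 4)) + 1"
      using z[of k] by linarith+
    then show "zcoord z n t \<le> zcoord z (Suc n) t"
      "zcoord z (Suc n) t + 1 / 2 ^ Suc n \<le> zcoord z n t + 1 / 2 ^ n"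
      unfolding zcoord_def zindex_refine[OF t, of n, symmetric] k_def[symmetric]
      by (simp_all add: divide_simps)
  qed
  show "zcoord z n t \<le> lim (\<lambda>n. zcoord z n t)"
    "lim (\<lambda>n. zcoord z n t) \<le> zcoord z n t + 1 / 2 ^ n"
    by (rule nested_dyadic_limit[of "\<lambda>n. zcoord z n t", OF step])+
qed

text \<open>For \<open>t\<close> in [0, 1) this is the common point of the nested closed cells
  assigned to \<open>t\<close>.\<close>

definition zpoint :: "real \<Rightarrow> real \<times> real" where
  "zpoint t = (lim (\<lambda>n. zcoord zcol n t), lim (\<lambda>n. zcoord zrow n t))"

lemma zpoint_bounds:
  assumes t: "0 \<le> t" "t < 1"
  shows "zcoord zcol n t \<le> fst (zpoint t)" "fst (zpoint t) \<le> zcoord zcol n t + 1 / 2 ^ n"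
    "zcoord zrow n t \<le> snd (zpoint t)" "snd (zpoint t) \<le> zcoord zrow n t + 1 / 2 ^ n"
  unfolding zpoint_def fst_conv snd_conv
  by (rule zcoord_limit[where z = zcol, OF t zcol_child] zcoord_limit[where z = zrow, OF t zrow_child])+

lemma measurable_zpoint [measurable]: "zpoint \<in> borel_measurable borel"
proof -
  have [measurable]: "zindex n \<in> borel \<rightarrow>\<^sub>M count_space UNIV" for n
    unfolding zindex_def by measurable
  have [measurable]: "zcoord z n \<in> borel_measurable borel" for z n
    unfolding zcoord_def by measurable
  have "(\<lambda>t. (lim (\<lambda>n. zcoord zcol n t), lim (\<lambda>n. zcoord zrow n t)))
      \<in> borel \<rightarrow>\<^sub>M borel \<Otimes>\<^sub>M borel"
    by measurable
  then show ?thesis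
    by (simp add: zpoint_def[abs_def] borel_prod)
qed

lemma zpoint_vimage: "zpoint -` ({0..u} \<times> {0..v}) \<in> sets unif01"
proof -
  have "zpoint -` ({0..u} \<times> {0..v}) \<inter> space borel \<in> sets borel"
    by (intro measurable_sets[OF measurable_zpoint] borel_closed closed_Times) auto
  then show ?thesis by simp
qed

text \<open>An interval of the parameter line. For \<open>k < 4 ^ n\<close>, \<open>zpoint\<close>
  maps it into the closed cell of the square with index \<open>k\<close>.\<close>

definition zcell :: "nat \<Rightarrow> nat \<Rightarrow> real set" where
  "zcell n k = {zstart n k..<zstart n (Suc k)}"

lemma measure_zcells:
  assumes B: "B \<subseteq> {..<4 ^ n}"
  shows "measure unif01 (\<Union>k\<in>B. zcell n k) = (\<Sum>k\<in>B. zmass n k)"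
proof -
  interpret prob_space unif01 by (rule prob_space_unif01)
  have fin: "finite B" using B finite_subset by blast
  have "measure unif01 (zcell n k) = zmass n k" if "k \<in> B" for k
  proof -
    have "0 \<le> zstart n k" "zstart n k \<le> zstart n (Suc k)" "zstart n (Suc k) \<le> 1"
      using zstart_mono[of 0 k n] zstart_mono[of k "Suc k" n] zstart_mono[of "Suc k" "4 ^ n" n]
        that B zstart_full[of n] by auto
    then have "zcell n k \<inter> {0..1} = zcell n k" unfolding zcell_def by auto
    then show ?thesis
      using \<open>zstart n k \<le> zstart n (Suc k)\<close>
      by (simp add: measure_unif01 zcell_def) (simp add: zstart_Suc)
  qed
  moreover have "disjoint_family_on (zcell n) B"
    unfolding disjoint_family_on_def zcell_def using zindex_unique by fastforce
  ultimately show ?thesis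
    using fin by (subst finite_measure_finite_Union) (auto simp: zcell_def)
qed

text \<open>Truncation at \<open>u\<close> and \<open>v\<close> keeps, of each cell, the mass left
  of \<open>u\<close> and below \<open>v\<close>. The increments add up to the one over the unit
  square, whose terms on the left and lower sides vanish.\<close>

lemma sum_zcell_clip:
  "(\<Sum>k<4 ^ n. zcell_mass (\<lambda>(x, y). copula_ext C (min x u, min y v)) n k) =
    copula_ext C (min 1 u, min 1 v)"
proof -
  have "copula_ext C (min 0 u, y) = 0" "copula_ext C (y, min 0 v) = 0" for y
    by (simp_all add: copula_ext_sides)
  then show ?thesis
    unfolding sum_zcell_mass rect_mass_def by (simp del: copula_ext_eq)
qed

text \<open>Clipping loses the mass of a strip on the right and of a strip on top. If the lower left
  corner is already cut off, the clipped rectangle is degenerate.\<close>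

lemma rect_mass_clip_le:
  assumes "a \<le> b" "c \<le> d"
  shows "rect_mass (copula_ext C) (min a u) (min b u) (min c v) (min d v) \<le>
    rect_mass (copula_ext C) a b c d"
proof (cases "a \<le> u \<and> c \<le> v")
  case True
  then have "0 \<le> rect_mass (copula_ext C) (min b u) b c d"
    "0 \<le> rect_mass (copula_ext C) a (min b u) (min d v) d"
    using assms by (auto intro!: rect_mass_nonneg)
  then show ?thesis
    using True by (simp add: rect_mass_def)
next
  case False
  then show ?thesis
    using rect_mass_nonneg[OF assms] assms by (auto simp: rect_mass_def)
qed

lemma zcell_mass_clip:
  "zcell_mass (\<lambda>(x, y). copula_ext C (min x u, min y v)) n k =
    rect_mass (copula_ext C) (min (zcol k / 2 ^ n) u) (min ((zcol k + 1) / 2 ^ n) u)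
      (min (zrow k / 2 ^ n) v) (min ((zrow k + 1) / 2 ^ n) v)"
  by (simp add: zcell_mass_def rect_mass_def)

lemma zcell_mass_clip_bounds:
  "0 \<le> zcell_mass (\<lambda>(x, y). copula_ext C (min x u, min y v)) n k"
  "zcell_mass (\<lambda>(x, y). copula_ext C (min x u, min y v)) n k \<le> zmass n k"
  unfolding zcell_mass_clip zmass_def zcell_mass_def[of "copula_ext C"]
  by (auto intro!: rect_mass_nonneg rect_mass_clip_le min.mono simp: divide_right_mono)

text \<open>A parameter in [0, 1) sent into the rectangle belongs to a cell whose lower left corner
  is at most \<open>(u, v)\<close>, hence to a cell inside the rectangle enlarged by
  \<open>e = 1 / 2 ^ n\<close> in both directions. By the Lipschitz bound the enlargement costs at
  most \<open>2 * e\<close>.\<close>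

lemma zpoint_measure_le:
  assumes uv: "0 \<le> u" "u \<le> 1" "0 \<le> v" "v \<le> 1"
  shows "measure unif01 (zpoint -` ({0..u} \<times> {0..v})) \<le> C u v + 2 / 2 ^ n"
proof -
  interpret prob_space unif01 by (rule prob_space_unif01)
  define e :: real where "e = 1 / 2 ^ n"
  define B where "B = {k. k < 4 ^ n \<and> zcol k / 2 ^ n \<le> u \<and> zrow k / 2 ^ n \<le> v}"
  let ?G = "\<lambda>(x, y). copula_ext C (min x (u + e), min y (v + e))"
  have "t \<in> (\<Union>k\<in>B. zcell n k)"
    if "0 \<le> t" "t < 1" "zpoint t \<in> {0..u} \<times> {0..v}" for t
  proof (rule UN_I)
    show "zindex n t \<in> B"
      using zindex(3)[OF that(1,2)] zpoint_bounds(1,3)[OF that(1,2), of n] that(3)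
      by (auto simp: B_def zcoord_def mem_Times_iff)
    show "t \<in> zcell n (zindex n t)"
      using zindex[OF that(1,2)] by (simp add: zcell_def)
  qed
  moreover have "AE t in unif01. 0 \<le> t \<and> t < 1"
    by (rule AE_unif01)
  ultimately have "prob (zpoint -` ({0..u} \<times> {0..v})) \<le> prob (\<Union>k\<in>B. zcell n k)"
    by (intro finite_measure_mono_AE) (auto simp: zcell_def B_def)
  also have "\<dots> = (\<Sum>k\<in>B. zmass n k)"
    by (rule measure_zcells) (auto simp: B_def)
  also have "\<dots> = (\<Sum>k\<in>B. zcell_mass ?G n k)"
  proof (rule sum.cong[OF refl])
    fix k assume "k \<in> B"
    then have "zcol k / 2 ^ n + e \<le> u + e" "zrow k / 2 ^ n + e \<le> v + e" "0 \<le> e"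
      by (auto simp: B_def e_def)
    moreover from this have "zcol k / 2 ^ n \<le> u + e" "zrow k / 2 ^ n \<le> v + e"
      by linarith+
    ultimately show "zmass n k = zcell_mass ?G n k"
      unfolding zcell_mass_clip
      by (simp add: zmass_def zcell_mass_def add_divide_distrib e_def min_absorb1 add.commute)
  qed
  also have "\<dots> \<le> (\<Sum>k<4 ^ n. zcell_mass ?G n k)"
    by (rule sum_mono2) (auto simp: B_def zcell_mass_clip_bounds)
  also have "\<dots> = copula_ext C (min 1 (u + e), min 1 (v + e))"
    by (rule sum_zcell_clip)
  also have "\<dots> \<le> copula_ext C (u, v) + (\<bar>min 1 (u + e) - u\<bar> + \<bar>min 1 (v + e) - v\<bar>)"
    using copula_ext_lipschitz[of "min 1 (u + e)" "min 1 (v + e)" u v] by linarith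
  also have "\<dots> \<le> copula_ext C (u, v) + 2 * e"
    using uv by (auto simp: e_def)
  finally show ?thesis using uv by (simp add: e_def)
qed

text \<open>Cells contained in the rectangle are hit only by parameters sent into it, and they carry
  all the mass of the rectangle shrunk by \<open>e\<close>.\<close>

lemma zpoint_measure_ge:
  assumes uv: "0 \<le> u" "u \<le> 1" "0 \<le> v" "v \<le> 1"
  shows "C u v - 2 / 2 ^ n \<le> measure unif01 (zpoint -` ({0..u} \<times> {0..v}))"
proof -
  interpret prob_space unif01 by (rule prob_space_unif01)
  define e :: real where "e = 1 / 2 ^ n"
  have e: "0 \<le> e" by (simp add: e_def)
  define B where "B = {k. k < 4 ^ n \<and> (zcol k + 1) / 2 ^ n \<le> u \<and> (zrow k + 1) / 2 ^ n \<le> v}"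
  let ?G = "\<lambda>(x, y). copula_ext C (min x (u - e), min y (v - e))"
  have "C u v - 2 * e \<le> copula_ext C (u - e, v - e)"
    using copula_ext_lipschitz[of "u - e" "v - e" u v] uv e by simp
  also have "\<dots> = (\<Sum>k<4 ^ n. zcell_mass ?G n k)"
    using uv e by (subst sum_zcell_clip) (simp add: min_absorb2)
  also have "\<dots> = (\<Sum>k\<in>B. zcell_mass ?G n k)"
  proof (rule sum.mono_neutral_right)
    \<comment> \<open>A cell that sticks out of the rectangle starts beyond \<open>u - e\<close> or
      \<open>v - e\<close>, so truncation there collapses it.\<close>
    show "\<forall>k\<in>{..<4 ^ n} - B. zcell_mass ?G n k = 0"
    proof
      fix k assume "k \<in> {..<4 ^ n} - B"
      then have "u - e \<le> zcol k / 2 ^ n \<or> v - e \<le> zrow k / 2 ^ n"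
        by (auto simp: B_def e_def add_divide_distrib)
      moreover have "zcol k / 2 ^ n \<le> (zcol k + 1) / 2 ^ n" "zrow k / 2 ^ n \<le> (zrow k + 1) / 2 ^ n"
        by (simp_all add: divide_right_mono)
      ultimately show "zcell_mass ?G n k = 0"
        unfolding zcell_mass_clip by (auto simp: rect_mass_def min_absorb2)
    qed
  qed (auto simp: B_def)
  also have "\<dots> \<le> (\<Sum>k\<in>B. zmass n k)"
    by (rule sum_mono) (rule zcell_mass_clip_bounds)
  also have "\<dots> = prob (\<Union>k\<in>B. zcell n k)"
    by (rule measure_zcells[symmetric]) (auto simp: B_def)
  also have "\<dots> \<le> prob (zpoint -` ({0..u} \<times> {0..v}))"
  proof (rule finite_measure_mono)
    show "(\<Union>k\<in>B. zcell n k) \<subseteq> zpoint -` ({0..u} \<times> {0..v})"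
    proof
      fix t assume "t \<in> (\<Union>k\<in>B. zcell n k)"
      then obtain k where k: "k \<in> B" and t: "t \<in> zcell n k"
        by blast
      have t01: "0 \<le> t" "t < 1"
        using t k zstart_mono[of 0 k n] zstart_mono[of "Suc k" "4 ^ n" n] zstart_full[of n]
        by (auto simp: zcell_def B_def)
      have "zindex n t = k"
        using t zindex[OF t01, of n] by (intro zindex_unique) (auto simp: zcell_def)
      then have "zcol k / 2 ^ n \<le> fst (zpoint t)" "fst (zpoint t) \<le> zcol k / 2 ^ n + 1 / 2 ^ n"
        "zrow k / 2 ^ n \<le> snd (zpoint t)" "snd (zpoint t) \<le> zrow k / 2 ^ n + 1 / 2 ^ n"
        using zpoint_bounds[OF t01, of n] by (simp_all add: zcoord_def)
      moreover have "0 \<le> zcol k / 2 ^ n" "0 \<le> zrow k / (2::real) ^ n" by simp_all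
      ultimately have "0 \<le> fst (zpoint t) \<and> fst (zpoint t) \<le> u"
        "0 \<le> snd (zpoint t) \<and> snd (zpoint t) \<le> v"
        using k unfolding B_def mem_Collect_eq add_divide_distrib of_nat_add of_nat_1 by linarith+
      then show "t \<in> zpoint -` ({0..u} \<times> {0..v})"
        by (simp add: mem_Times_iff)
    qed
    show "zpoint -` ({0..u} \<times> {0..v}) \<in> events"
      by (rule zpoint_vimage)
  qed
  finally show ?thesis by (simp add: e_def)
qed

lemma copula_law_zpoint: "copula_law C (distr unif01 borel zpoint)"
  unfolding copula_law_def
proof (intro conjI ballI)
  show "prob_space (distr unif01 borel zpoint)"
    by (intro prob_space.prob_space_distr prob_space_unif01) simp
  fix u v :: real assume "u \<in> {0..1}" "v \<in> {0..1}"
  then have uv: "0 \<le> u" "u \<le> 1" "0 \<le> v" "v \<le> 1" by auto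
  let ?m = "measure unif01 (zpoint -` ({0..u} \<times> {0..v}))"
  have lim: "(\<lambda>n. c / 2 ^ n) \<longlonglongrightarrow> 0" for c :: real
    using tendsto_mult_right_zero[OF LIMSEQ_power_zero[of "1 / 2 :: real"], of c]
    by (simp add: power_one_over divide_simps)
  have "(\<lambda>n. C u v + 2 / 2 ^ n) \<longlonglongrightarrow> C u v + 0" "(\<lambda>n. C u v - 2 / 2 ^ n) \<longlonglongrightarrow> C u v - 0"
    by (fast intro: tendsto_add[OF tendsto_const lim] tendsto_diff[OF tendsto_const lim])+
  then have "?m \<le> C u v + 0" "C u v - 0 \<le> ?m"
    using zpoint_measure_le[OF uv] zpoint_measure_ge[OF uv]
    by (blast intro: LIMSEQ_le_const LIMSEQ_le_const2)+
  then have "?m = C u v"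
    by simp
  then show "measure (distr unif01 borel zpoint) ({0..u} \<times> {0..v}) = C u v"
    by (subst measure_distr) (auto simp: borel_closed closed_Times)
qed simp

end

lemma copula_law_copula_measure:
  assumes "copula C"
  shows "copula_law C (copula_measure C)"
  using copula_law_zpoint[OF assms] copula_measure_eq[OF _ assms] by metis

section \<open>Bounds on Kendalls tau\<close>

lemma LBINT_Icc_FTC:
  fixes F f :: "real \<Rightarrow> real"
  assumes "a \<le> b" "\<And>x. (F has_real_derivative f x) (at x)" "\<And>x. isCont f x"
  shows "(LBINT x:{a..b}. f x) = F b - F a"
  using integral_FTC_Icc_real[of a b F f] assms
  by (simp add: set_lebesgue_integral_def mult.commute)

lemma integral_unif01_id: "(\<integral>x. x \<partial>unif01) = 1 / 2"
proof -
  have "(LBINT x:{0..1}. x) = 1\<^sup>2 / 2 - 0\<^sup>2 / (2::real)"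
    by (rule LBINT_Icc_FTC) (auto intro!: derivative_eq_intros)
  then show ?thesis by (simp add: integral_unif01)
qed

lemma copula_transpose: "copula C \<Longrightarrow> copula (\<lambda>u v. C v u)"
  unfolding copula_def by (auto simp: algebra_simps)

section \<open>Uniform margins, and integral criteria for the two bounds\<close>

context
  fixes C M
  assumes C: "copula C" and L: "copula_law C M"
begin

interpretation prob_space M
  using L by (simp add: copula_law_def)

lemma copula_law_sets [measurable_cong]: "sets M = sets borel"
  using L by (simp add: copula_law_def)

lemma copula_law_measurable [measurable]: "fst \<in> borel_measurable M" "snd \<in> borel_measurable M"
  by (simp_all add: measurable_cong_sets[OF copula_law_sets refl] borel_measurable_continuous_onI
      continuous_on_fst continuous_on_snd)

lemma copula_law_margins:
  "distr M borel fst = unif01" "distr M borel snd = unif01"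
proof -
  interpret U: prob_space unif01 by (rule prob_space_unif01)
  have unif: "measure unif01 {..x} = unit_clip x" for x
  proof -
    have "{..x} \<inter> {0..1} = (if x < 0 then {} else {0..unit_clip x})"
      by (auto simp: unit_clip_def)
    then show ?thesis
      by (simp add: measure_unif01) (simp add: unit_clip_def)
  qed
  have sq: "AE p in M. p \<in> {0..1} \<times> {0..1}" by (rule copula_law_square[OF L C])
  have fst: "prob (fst -` {..x} \<inter> space M) = unit_clip x"
    and snd: "prob (snd -` {..x} \<inter> space M) = unit_clip x" for x
  proof -
    have [measurable]: "{..p} \<in> events" for p by (simp add: copula_law_sets)
    have "space M = UNIV"
      using sets_eq_imp_space_eq[OF copula_law_sets] by simp
    then have 1: "AE p in M. p \<in> fst -` {..x} \<inter> space M \<longleftrightarrow> p \<in> {..(x, 1)}"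
      and 2: "AE p in M. p \<in> snd -` {..x} \<inter> space M \<longleftrightarrow> p \<in> {..(1, x)}"
      by (auto intro: eventually_mono[OF sq])
    have "prob (fst -` {..x} \<inter> space M) = prob {..(x, 1)}"
      by (rule finite_measure_eq_AE[OF 1]; measurable)
    moreover have "prob (snd -` {..x} \<inter> space M) = prob {..(1, x)}"
      by (rule finite_measure_eq_AE[OF 2]; measurable)
    ultimately show "prob (fst -` {..x} \<inter> space M) = unit_clip x"
      "prob (snd -` {..x} \<inter> space M) = unit_clip x"
      using copula_margins(3,4)[OF C unit_clip_range(1,2), of x]
      by (simp_all add: copula_law_atMost[OF L C] copula_ext_def)
  qed
  have U: "real_distribution unif01"
    by (simp add: real_distribution_def real_distribution_axioms_def U.prob_space_axioms)
  show "distr M borel fst = unif01"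
    by (rule cdf_unique[OF real_distribution_distr U])
      (auto simp: cdf_def measure_distr fst unif fun_eq_iff)
  show "distr M borel snd = unif01"
    by (rule cdf_unique[OF real_distribution_distr U])
      (auto simp: cdf_def measure_distr snd unif fun_eq_iff)
qed

lemma copula_law_mean: "(\<integral>p. fst p \<partial>M) = 1 / 2" "(\<integral>p. snd p \<partial>M) = 1 / 2"
proof -
  have "(\<integral>x. x \<partial>distr M borel fst) = (\<integral>p. fst p \<partial>M)" "(\<integral>x. x \<partial>distr M borel snd) = (\<integral>p. snd p \<partial>M)"
    by (rule integral_distr; simp)+
  then show "(\<integral>p. fst p \<partial>M) = 1 / 2" "(\<integral>p. snd p \<partial>M) = 1 / 2"
    unfolding copula_law_margins integral_unif01_id by (metis)+
qed

lemma copula_law_integrable: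
  "integrable M (\<lambda>p. fst p)" "integrable M (\<lambda>p. snd p)" "integrable M (copula_ext C)"
proof -
  have sq: "AE p in M. p \<in> {0..1} \<times> {0..1}" by (rule copula_law_square[OF L C])
  have "AE p in M. norm (fst p) \<le> 1" using sq by eventually_elim auto
  moreover have "AE p in M. norm (snd p) \<le> 1" using sq by eventually_elim auto
  ultimately show "integrable M (\<lambda>p. fst p)" "integrable M (\<lambda>p. snd p)"
    by (simp_all add: integrable_const_bound)
  show "integrable M (copula_ext C)"
    by (rule integrable_copula_ext[OF prob_space_axioms copula_law_sets C])
qed

lemma copula_law_integrable_indicator:
  "A \<in> sets borel \<Longrightarrow> integrable M (indicator A :: real \<times> real \<Rightarrow> real)"
  by (intro integrable_real_indicator) (simp_all add: copula_law_sets less_top[symmetric])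

text \<open>Integrating the pointwise bound puts \<open>m * measure M A\<close>, hence the square of
  \<open>m\<close>, below the integral of \<open>C\<close>. The set \<open>A\<close> will be one of
  the three cells, with another of them below and to the left of it.\<close>

lemma kendall_tau_geI:
  assumes A: "A \<in> sets borel" "m \<le> measure M A" and m: "0 \<le> m"
    and le: "\<And>u v. 0 \<le> u \<Longrightarrow> u \<le> 1 \<Longrightarrow> 0 \<le> v \<Longrightarrow> v \<le> 1 \<Longrightarrow> m * indicator A (u, v) \<le> C u v"
  shows "4 * m\<^sup>2 - 1 \<le> kendall_tau C"
proof -
  have [measurable]: "A \<in> events" using A by (simp add: copula_law_sets)
  have "m * m \<le> m * measure M A" using A m by (intro mult_left_mono)
  also have "\<dots> = (\<integral>p. m * indicator A p \<partial>M)" by simp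
  also have "\<dots> \<le> (\<integral>p. copula_ext C p \<partial>M)"
  proof (rule integral_mono_AE)
    show "AE p in M. m * indicator A p \<le> copula_ext C p"
      using copula_law_square[OF L C] by (rule AE_mp) (auto intro!: AE_I2 le)
  qed (auto intro: copula_law_integrable copula_law_integrable_indicator A)
  finally show ?thesis
    by (simp add: kendall_tau_eq[OF L C] power2_eq_square)
qed

text \<open>Since both margins have mean 1/2, an upper bound on \<open>\<integral>C dC\<close> is a lower bound on
  the integral of \<open>u + v - 2 C(u, v)\<close>, the mass of the points discordant with \<open>(u, v)\<close>.\<close>

lemma kendall_tau_leI:
  assumes A: "A1 \<in> sets borel" "A2 \<in> sets borel" "A3 \<in> sets borel"
      "m \<le> measure M A1" "m \<le> measure M A2" "m \<le> measure M A3" and m: "0 \<le> m"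
    and le: "\<And>u v. 0 \<le> u \<Longrightarrow> u \<le> 1 \<Longrightarrow> 0 \<le> v \<Longrightarrow> v \<le> 1 \<Longrightarrow>
      m * indicator A1 (u, v) + 2 * m * indicator A2 (u, v) + m * indicator A3 (u, v)
        \<le> u + v - 2 * C u v"
  shows "kendall_tau C \<le> 1 - 8 * m\<^sup>2"
proof -
  have [measurable]: "A1 \<in> events" "A2 \<in> events" "A3 \<in> events"
    using A by (simp_all add: copula_law_sets)
  have "m * m \<le> m * measure M A1" "m * m \<le> m * measure M A2" "m * m \<le> m * measure M A3"
    using A m by (intro mult_left_mono; simp)+
  \<comment> \<open>The weights 1, 2, 1 count, for each cell, how many of the other two are
    discordant with it.\<close>
  then have "4 * m\<^sup>2 \<le> m * measure M A1 + 2 * m * measure M A2 + m * measure M A3"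
    by (simp add: power2_eq_square)
  also have "\<dots> = (\<integral>p. m * indicator A1 p + 2 * m * indicator A2 p + m * indicator A3 p \<partial>M)"
    by (simp add: copula_law_integrable_indicator A)
  also have "\<dots> \<le> (\<integral>p. fst p + snd p - 2 * copula_ext C p \<partial>M)"
  proof (rule integral_mono_AE)
    show "AE p in M. m * indicator A1 p + 2 * m * indicator A2 p + m * indicator A3 p
        \<le> fst p + snd p - 2 * copula_ext C p"
      using copula_law_square[OF L C] by (rule AE_mp) (auto intro!: AE_I2 le)
  qed (intro copula_law_integrable copula_law_integrable_indicator A Bochner_Integration.integrable_add
      Bochner_Integration.integrable_diff integrable_mult_right)+
  also have "\<dots> = 1 - 2 * (\<integral>p. copula_ext C p \<partial>M)"
    using copula_law_integrable by (simp add: copula_law_mean)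
  finally show ?thesis
    by (simp add: kendall_tau_eq[OF L C])
qed

end

text \<open>With \<open>p i j\<close> the masses of the cells of the grid with lines at \<open>a\<close> and \<open>b\<close>, the margins give
  \<open>p 1 2 - p 2 1 = p 2 3 - p 3 2 = p 3 1 - p 1 3 = m\<close>, so the cells (1,2), (2,3), (3,1) carry
  mass at least \<open>m\<close> each. The first two are concordant with each other, and both are
  discordant with the third.\<close>

lemma copula_three_cells:
  assumes C: "copula C" and ab: "0 \<le> a" "a \<le> b" "b \<le> 1" and m: "C a b - C b a = m" "0 \<le> m"
  shows "m \<le> C a b - C a a" "m \<le> a - C b a" "m \<le> b - a - C b b + C a b"
    and "\<And>u v. 0 \<le> u \<Longrightarrow> u \<le> 1 \<Longrightarrow> 0 \<le> v \<Longrightarrow> v \<le> 1 \<Longrightarrow>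
      m * indicator ({0<..a} \<times> {a<..b}) (u, v) + 2 * m * indicator ({b<..1} \<times> {0<..a}) (u, v) +
      m * indicator ({a<..b} \<times> {b<..1}) (u, v) \<le> u + v - 2 * C u v"
    and "\<And>u v. 0 \<le> u \<Longrightarrow> u \<le> 1 \<Longrightarrow> 0 \<le> v \<Longrightarrow> v \<le> 1 \<Longrightarrow>
      m * indicator ({a<..b} \<times> {b<..1}) (u, v) \<le> C u v"
proof -
  note inc = copula_increasing[OF C] and marg = copula_margins[OF C] and bnd = copula_bounds[OF C]
  have Cab: "C a b \<le> a" and aa: "C a a \<le> C b a"
    using bnd[of a b] inc[of a b 0 a] marg[of a] marg[of b] ab by auto
  show 1: "m \<le> C a b - C a a" and 2: "m \<le> a - C b a"
    using Cab aa m by auto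
  \<comment> \<open>This is the mass of cell (3,2); that of cell (2,3) exceeds it by
    \<open>m\<close>.\<close>
  have "0 \<le> b - a - C b b + C b a"
    using inc[of b 1 a b] marg[of a] marg[of b] ab by auto
  then show 3: "m \<le> b - a - C b b + C a b"
    using m by simp
  \<comment> \<open>The right side is the mass of \<open>{0..b} \<times> {a<..1}\<close>, which
    contains the cells (1,2) and (2,3).\<close>
  have b2: "2 * m \<le> b - C b a"
    using 1 2 3 inc[of a b a b] aa m ab Cab by auto
  \<comment> \<open>\<open>v - C u v\<close> is the mass to the right of \<open>u\<close> and up to
    \<open>v\<close>, which includes cell (3,1).\<close>
  have right: "m \<le> v - C u v" if "0 \<le> u" "u \<le> b" "a \<le> v" "v \<le> 1" for u v
    using inc[of u 1 a v] inc[of u b 0 a] marg[of v] marg[of a] marg[of u] marg[of b] that ab 2 by auto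
  \<comment> \<open>\<open>u - C u v\<close> is the mass up to \<open>u\<close> and above
    \<open>v\<close>, which includes the region of \<open>b2\<close>.\<close>
  have below: "2 * m \<le> u - C u v" if "b \<le> u" "u \<le> 1" "0 \<le> v" "v \<le> a" for u v
    using inc[of b u v 1] inc[of 0 b v a] marg[of u] marg[of b] marg[of v] marg[of a] that ab b2 by auto
  fix u v :: real
  assume uv: "0 \<le> u" "u \<le> 1" "0 \<le> v" "v \<le> 1"
  show "m * indicator ({0<..a} \<times> {a<..b}) (u, v) + 2 * m * indicator ({b<..1} \<times> {0<..a}) (u, v) +
      m * indicator ({a<..b} \<times> {b<..1}) (u, v) \<le> u + v - 2 * C u v"
    using right[of u v] below[of u v] bnd[OF uv] uv ab m(2)
    by (auto simp: indicator_def)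
  have "m \<le> C u v" if "a \<le> u" "b \<le> v"
    using inc[of a u 0 v] inc[of 0 a b v] marg[of u] marg[of v] marg[of a] marg[of b]
      bnd[of b a] that uv ab m by auto
  then show "m * indicator ({a<..b} \<times> {b<..1}) (u, v) \<le> C u v"
    using bnd[OF uv] by (auto simp: indicator_def)
qed

lemma kendall_tau_bounds_aux:
  assumes C: "copula C" and ab: "0 \<le> a" "a \<le> b" "b \<le> 1"
  defines "m \<equiv> \<bar>C a b - C b a\<bar>"
  shows "4 * m\<^sup>2 - 1 \<le> kendall_tau C" "kendall_tau C \<le> 1 - 8 * m\<^sup>2"
proof -
  note L = copula_law_copula_measure[OF C]
  note cell = copula_law_cell[OF L C] and marg = copula_margins[OF C]
  have [simp]: "{x<..y} \<times> {z<..w} \<in> sets borel" for x y z w :: real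
    by (simp add: borel_prod[symmetric])
  have m: "0 \<le> m" by (simp add: m_def)
  have "4 * m\<^sup>2 - 1 \<le> kendall_tau C \<and> kendall_tau C \<le> 1 - 8 * m\<^sup>2"
  proof (cases "C b a \<le> C a b")
    case True
    then have "C a b - C b a = m" by (simp add: m_def)
    note three = copula_three_cells[OF C ab this m]
    show ?thesis
      using three(1-3) marg[of a] marg[of b] marg[of 1] ab m
      by (intro conjI kendall_tau_geI[OF C L _ _ _ three(5)] kendall_tau_leI[OF C L _ _ _ _ _ _ _ three(4)])
        (auto simp: cell)
  next
    case False
    \<comment> \<open>The cells found for the transpose are reflected in the diagonal and then used
      for \<open>C\<close> itself, so tau need not be compared with that of the transpose.\<close>
    then have "(\<lambda>u v. C v u) a b - (\<lambda>u v. C v u) b a = m" by (simp add: m_def)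
    note three = copula_three_cells[OF copula_transpose[OF C] ab this m]
    have swap: "indicator (X \<times> Y) (v, u) = (indicator (Y \<times> X) (u, v) :: real)"
      for X Y :: "real set" and u v
      by (auto simp: indicator_def)
    have le: "m * indicator ({a<..b} \<times> {0<..a}) (u, v) + 2 * m * indicator ({0<..a} \<times> {b<..1}) (u, v) +
        m * indicator ({b<..1} \<times> {a<..b}) (u, v) \<le> u + v - 2 * C u v"
      if "0 \<le> u" "u \<le> 1" "0 \<le> v" "v \<le> 1" for u v
      using three(4)[of v u] that
      unfolding swap[of "{0<..a}" "{a<..b}" v u] swap[of "{b<..1}" "{0<..a}" v u]
        swap[of "{a<..b}" "{b<..1}" v u] by linarith
    have "4 * m\<^sup>2 - 1 \<le> kendall_tau C"
      using three(1-3) three(5) marg[of a] marg[of b] marg[of 1] ab m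
      by (intro kendall_tau_geI[OF C L, of "{b<..1} \<times> {a<..b}"]) (auto simp: cell swap)
    moreover have "kendall_tau C \<le> 1 - 8 * m\<^sup>2"
      using three(1-3) marg[of a] marg[of b] marg[of 1] ab m
      by (intro kendall_tau_leI[OF C L _ _ _ _ _ _ _ le]) (auto simp: cell)
    ultimately show ?thesis by simp
  qed
  then show "4 * m\<^sup>2 - 1 \<le> kendall_tau C" "kendall_tau C \<le> 1 - 8 * m\<^sup>2" by auto
qed

lemma kendall_tau_bounds:
  assumes C: "copula C"
  shows "4 * (asymmetry C)\<^sup>2 - 1 \<le> kendall_tau C" "kendall_tau C \<le> 1 - 8 * (asymmetry C)\<^sup>2"
proof -
  obtain u v where uv: "u \<in> {0..1}" "v \<in> {0..1}" and eq: "asymmetry C = \<bar>C u v - C v u\<bar>"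
    using asymmetry_attained[OF C] by blast
  define a where "a = min u v"
  define b where "b = max u v"
  have "asymmetry C = \<bar>C a b - C b a\<bar>"
    using eq by (auto simp: a_def b_def min_def max_def)
  moreover have "0 \<le> a" "a \<le> b" "b \<le> 1"
    using uv by (auto simp: a_def b_def)
  ultimately show "4 * (asymmetry C)\<^sup>2 - 1 \<le> kendall_tau C"
    "kendall_tau C \<le> 1 - 8 * (asymmetry C)\<^sup>2"
    using kendall_tau_bounds_aux[OF C] by simp_all
qed

section \<open>Convex combinations\<close>

definition copula_mix ::
    "real \<Rightarrow> (real \<Rightarrow> real \<Rightarrow> real) \<Rightarrow> (real \<Rightarrow> real \<Rightarrow> real) \<Rightarrow> real \<Rightarrow> real \<Rightarrow> real" where
  "copula_mix s C D u v = (1 - s) * C u v + s * D u v"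

lemma copula_copula_mix:
  assumes C: "copula C" and D: "copula D" and s: "0 \<le> s" "s \<le> 1"
  shows "copula (copula_mix s C D)"
proof -
  have "0 \<le> copula_mix s C D b d - copula_mix s C D b c - copula_mix s C D a d + copula_mix s C D a c"
    if "0 \<le> a" "a \<le> b" "b \<le> 1" "0 \<le> c" "c \<le> d" "d \<le> 1" for a b c d
  proof -
    have "0 \<le> (1 - s) * (C b d - C b c - C a d + C a c) + s * (D b d - D b c - D a d + D a c)"
      using copula_increasing[OF C that] copula_increasing[OF D that] s
      by (intro add_nonneg_nonneg[OF mult_nonneg_nonneg mult_nonneg_nonneg]) simp_all
    then show ?thesis
      by (simp add: copula_mix_def algebra_simps)
  qed
  then show ?thesis
    using copula_margins[OF C] copula_margins[OF D]
    unfolding copula_def by (auto simp: copula_mix_def algebra_simps)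
qed

text \<open>The combination (1 - s) M + s N as a two-stage experiment: a Bernoulli trial selects the
  measure from which the point is drawn.\<close>

definition measure_mix :: "real \<Rightarrow> (real \<times> real) measure \<Rightarrow> (real \<times> real) measure \<Rightarrow> (real \<times> real) measure" where
  "measure_mix s M N = measure_pmf (bernoulli_pmf s) \<bind> (\<lambda>b. if b then N else M)"

context
  fixes M N :: "(real \<times> real) measure" and s :: real
  assumes M: "prob_space M" "sets M = sets borel" and N: "prob_space N" "sets N = sets borel"
    and s: "0 \<le> s" "s \<le> 1"
begin

lemma measure_mix_kernel:
  "(\<lambda>b. if b then N else M) \<in> measure_pmf (bernoulli_pmf s) \<rightarrow>\<^sub>M subprob_algebra borel"
proof -
  have "N \<in> space (subprob_algebra borel)" "M \<in> space (subprob_algebra borel)"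
    using M N prob_space_imp_subprob_space by (simp_all add: space_subprob_algebra)
  then show ?thesis
    unfolding measurable_pmf_measure1 by simp
qed

lemma sets_measure_mix: "sets (measure_mix s M N) = sets borel"
  unfolding measure_mix_def by (rule sets_bind_measurable[OF measure_mix_kernel]) simp

lemma prob_space_measure_mix: "prob_space (measure_mix s M N)"
  unfolding measure_mix_def
  using M(1) N(1) by (intro measure_pmf.prob_space_bind[OF _ measure_mix_kernel]) auto

lemma integral_measure_mix:
  assumes f: "f \<in> borel_measurable borel" "\<And>p. 0 \<le> f p" "\<And>p. f p \<le> (1 :: real)"
  shows "(\<integral>p. f p \<partial>measure_mix s M N) = (1 - s) * (\<integral>p. f p \<partial>M) + s * (\<integral>p. f p \<partial>N)"
proof -
  have nn: "(\<integral>\<^sup>+p. f p \<partial>K) = ennreal (\<integral>p. f p \<partial>K)"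
    if K: "prob_space K" "sets K = sets borel" for K
  proof -
    interpret prob_space K by (rule K)
    have "integrable K f"
      using f by (intro integrable_const_bound[of _ 1]) (auto simp: measurable_cong_sets[OF K(2) refl])
    then show ?thesis using f by (intro nn_integral_eq_integral) auto
  qed
  have pos: "0 \<le> (\<integral>p. f p \<partial>K)" for K using f by simp
  have "ennreal (\<integral>p. f p \<partial>measure_mix s M N) = (\<integral>\<^sup>+p. f p \<partial>measure_mix s M N)"
    by (rule nn[OF prob_space_measure_mix sets_measure_mix, symmetric])
  also have "\<dots> = (\<integral>\<^sup>+b. \<integral>\<^sup>+p. f p \<partial>(if b then N else M) \<partial>measure_pmf (bernoulli_pmf s))"
    unfolding measure_mix_def using f(1) by (intro nn_integral_bind[OF _ measure_mix_kernel]) simp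
  also have "\<dots> = ennreal (\<integral>p. f p \<partial>N) * ennreal s + ennreal (\<integral>p. f p \<partial>M) * ennreal (1 - s)"
    using s nn[OF M] nn[OF N] by simp
  also have "\<dots> = ennreal ((1 - s) * (\<integral>p. f p \<partial>M) + s * (\<integral>p. f p \<partial>N))"
    using s pos by (simp add: ennreal_mult[symmetric] ennreal_plus[symmetric] mult.commute add.commute
        del: ennreal_plus)
  finally show ?thesis
    using s pos by (subst (asm) ennreal_inj) auto
qed

end

lemma copula_law_mix:
  assumes "copula C" "copula_law C M" "copula D" "copula_law D N" "0 \<le> s" "s \<le> 1"
  shows "copula_law (copula_mix s C D) (measure_mix s M N)"
proof -
  have M: "prob_space M" "sets M = sets borel" and N: "prob_space N" "sets N = sets borel"
    using assms by (simp_all add: copula_law_def)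
  have "measure (measure_mix s M N) ({0..u} \<times> {0..v}) = copula_mix s C D u v"
    if "u \<in> {0..1}" "v \<in> {0..1}" for u v
  proof -
    have Q: "{0..u} \<times> {0..v} \<in> sets borel"
      by (simp add: borel_closed closed_Times)
    have "space K = UNIV" if "sets K = sets borel" for K :: "(real \<times> real) measure"
      using sets_eq_imp_space_eq[OF that] by simp
    then have eq: "(\<integral>p. indicator ({0..u} \<times> {0..v}) p \<partial>K) = measure K ({0..u} \<times> {0..v})"
      if "sets K = sets borel" for K
      using that by simp
    show ?thesis
      using integral_measure_mix[OF M N assms(5,6), of "indicator ({0..u} \<times> {0..v})"] Q that assms
      by (simp add: eq M N sets_measure_mix[OF M N assms(5,6)] copula_law_def copula_mix_def
          indicator_le_1)
  qed
  then show ?thesis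
    using prob_space_measure_mix[OF M N assms(5,6)] sets_measure_mix[OF M N assms(5,6)]
    by (simp add: copula_law_def)
qed

text \<open>The integral of one copula against the law of another is affine in each argument, so tau
  is a quadratic polynomial in \<open>s\<close> along the segment, and the intermediate value
  theorem applies.\<close>

lemma kendall_tau_mix_intermediate:
  assumes C: "copula C" and D: "copula D" and t: "kendall_tau C \<le> t" "t \<le> kendall_tau D"
  shows "\<exists>s\<in>{0..1}. kendall_tau (copula_mix s C D) = t"
proof -
  define M N where "M = copula_measure C" and "N = copula_measure D"
  have L: "copula_law C M" "copula_law D N"
    unfolding M_def N_def by (rule copula_law_copula_measure C D)+
  have M: "prob_space M" "sets M = sets borel" and N: "prob_space N" "sets N = sets borel"
    using L by (simp_all add: copula_law_def)
  define h where "h s = 4 *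
      ((1 - s) * ((1 - s) * (\<integral>p. copula_ext C p \<partial>M) + s * (\<integral>p. copula_ext D p \<partial>M)) +
       s * ((1 - s) * (\<integral>p. copula_ext C p \<partial>N) + s * (\<integral>p. copula_ext D p \<partial>N))) - 1" for s
  have h: "kendall_tau (copula_mix s C D) = h s" if s: "0 \<le> s" "s \<le> 1" for s
  proof -
    have mix: "copula (copula_mix s C D)"
      by (rule copula_copula_mix[OF C D s])
    have ext: "copula_ext (copula_mix s C D) = (\<lambda>p. (1 - s) * copula_ext C p + s * copula_ext D p)"
      by (simp add: copula_ext_def copula_mix_def fun_eq_iff)
    have "(\<integral>p. copula_ext (copula_mix s C D) p \<partial>measure_mix s M N) =
        (1 - s) * (\<integral>p. copula_ext (copula_mix s C D) p \<partial>M) + s * (\<integral>p. copula_ext (copula_mix s C D) p \<partial>N)"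
      by (intro integral_measure_mix M N s measurable_copula_ext copula_ext_bounded mix)
    then show ?thesis
      unfolding kendall_tau_eq[OF copula_law_mix[OF C L(1) D L(2) s] mix] h_def
      by (simp add: ext integrable_copula_ext[OF M C] integrable_copula_ext[OF M D]
          integrable_copula_ext[OF N C] integrable_copula_ext[OF N D])
  qed
  have "continuous_on {0..1} h"
    unfolding h_def by (intro continuous_intros)
  moreover have "h 0 \<le> t" "t \<le> h 1"
    using t by (simp_all add: h_def kendall_tau_eq[OF L(1) C] kendall_tau_eq[OF L(2) D])
  ultimately obtain s where "0 \<le> s" "s \<le> 1" "h s = t"
    using IVT'[of h 0 t 1] by auto
  then show ?thesis using h by auto
qed

text \<open>The difference is signed and tied to a fixed point, so that in a convex combination the
  maximal differences add up instead of cancelling.\<close>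

definition asymmetric_at :: "real \<Rightarrow> real \<Rightarrow> real \<Rightarrow> (real \<Rightarrow> real \<Rightarrow> real) \<Rightarrow> bool" where
  "asymmetric_at m a b C \<longleftrightarrow> C a b - C b a = m \<and>
     (\<forall>u\<in>{0..1}. \<forall>v\<in>{0..1}. \<bar>C u v - C v u\<bar> \<le> m)"

lemma asymmetry_eqI:
  assumes C: "copula C" and ab: "a \<in> {0..1}" "b \<in> {0..1}" and at: "asymmetric_at m a b C"
  shows "asymmetry C = m"
proof -
  obtain u v where uv: "u \<in> {0..1}" "v \<in> {0..1}" "asymmetry C = \<bar>C u v - C v u\<bar>"
    and max: "\<forall>u'\<in>{0..1}. \<forall>v'\<in>{0..1}. \<bar>C u' v' - C v' u'\<bar> \<le> \<bar>C u v - C v u\<bar>"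
    using asymmetry_attained[OF C] by blast
  have "\<bar>C u v - C v u\<bar> \<le> m" "C a b - C b a = m"
    using at uv by (auto simp: asymmetric_at_def)
  moreover have "\<bar>C a b - C b a\<bar> \<le> \<bar>C u v - C v u\<bar>"
    using max ab by blast
  ultimately show ?thesis using uv by linarith
qed

lemma asymmetric_at_mix:
  assumes C: "asymmetric_at m a b C" and D: "asymmetric_at m a b D" and s: "0 \<le> s" "s \<le> 1"
  shows "asymmetric_at m a b (copula_mix s C D)"
  unfolding asymmetric_at_def
proof (intro conjI ballI)
  have diff: "copula_mix s C D u v - copula_mix s C D v u = (1 - s) * (C u v - C v u) + s * (D u v - D v u)"
    for u v by (simp add: copula_mix_def algebra_simps)
  show "copula_mix s C D a b - copula_mix s C D b a = m"
    using C D unfolding diff asymmetric_at_def by (simp add: algebra_simps)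
  fix u v :: real assume uv: "u \<in> {0..1}" "v \<in> {0..1}"
  have "\<bar>(1 - s) * (C u v - C v u) + s * (D u v - D v u)\<bar> \<le> (1 - s) * m + s * m"
    using C D uv s unfolding asymmetric_at_def
    by (intro order_trans[OF abs_triangle_ineq] add_mono) (auto simp: abs_mult intro!: mult_left_mono)
  then show "\<bar>copula_mix s C D u v - copula_mix s C D v u\<bar> \<le> m"
    unfolding diff by (simp add: algebra_simps)
qed

lemma asymmetric_at_intermediate:
  assumes "copula C" "copula D" "kendall_tau C \<le> t" "t \<le> kendall_tau D"
    and "asymmetric_at m a b C" "asymmetric_at m a b D" "a \<in> {0..1}" "b \<in> {0..1}"
  shows "\<exists>C. copula C \<and> asymmetry C = m \<and> kendall_tau C = t"
proof -
  obtain s where s: "s \<in> {0..1}" "kendall_tau (copula_mix s C D) = t"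
    using kendall_tau_mix_intermediate assms(1-4) by blast
  have "copula (copula_mix s C D)"
    using s assms by (intro copula_copula_mix) auto
  moreover have "asymmetric_at m a b (copula_mix s C D)"
    using s assms by (intro asymmetric_at_mix) auto
  ultimately show ?thesis
    using s asymmetry_eqI assms(7,8) by blast
qed

text \<open>The rectangle inequality and the zero values on the lower and left sides come from
  monotonicity of the measure, so only the margins have to be supplied.\<close>

lemma copula_of_measure:
  assumes M: "prob_space M" "sets M = sets borel"
    and C: "\<And>u v. u \<in> {0..1} \<Longrightarrow> v \<in> {0..1} \<Longrightarrow> measure M ({0..u} \<times> {0..v}) = C u v"
    and marg: "\<And>u. u \<in> {0..1} \<Longrightarrow> C u 1 = u" "\<And>u. u \<in> {0..1} \<Longrightarrow> C 1 u = u"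
  shows "copula C" "copula_law C M"
proof -
  interpret prob_space M by (rule M)
  have Q [simp]: "{x..y} \<times> {z..w} \<in> events" for x y z w :: real
    by (simp add: M borel_closed closed_Times)
  show "copula_law C M"
    using M C by (simp add: copula_law_def)
  have ground: "C u 0 = 0" "C 0 u = 0" if "u \<in> {0..1}" for u
  proof -
    \<comment> \<open>The whole lower side has measure \<open>C 1 0 = 0\<close>, by the margin at
      0.\<close>
    have "prob ({0..u} \<times> {0..0}) \<le> prob ({0..1} \<times> {0..0})"
      by (rule finite_measure_mono[OF _ Q]) (use that in auto)
    moreover have "prob ({0..0} \<times> {0..u}) \<le> prob ({0..0} \<times> {0..1})"
      by (rule finite_measure_mono[OF _ Q]) (use that in auto)
    ultimately have "C u 0 \<le> 0" "C 0 u \<le> 0"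
      using C[of u 0] C[of 0 u] C[of 1 0] C[of 0 1] marg[of 0] that by simp_all
    then show "C u 0 = 0" "C 0 u = 0"
      using C[of u 0] C[of 0 u] that measure_nonneg[of M "{0..u} \<times> {0..0}"]
        measure_nonneg[of M "{0..0} \<times> {0..u}"] by simp_all
  qed
  have "0 \<le> C b d - C b c - C a d + C a c"
    if "a \<in> {0..1}" "b \<in> {0..1}" "c \<in> {0..1}" "d \<in> {0..1}" "a \<le> b" "c \<le> d" for a b c d
  proof -
    let ?P = "{0..b} \<times> {0..c}" and ?Q = "{0..a} \<times> {0..d}"
    have "?Q \<inter> ?P = {0..a} \<times> {0..c}" using that by auto
    then have "prob ?P + (prob ?Q - prob ({0..a} \<times> {0..c})) = prob (?P \<union> ?Q)"
      by (simp add: finite_measure_Union' finite_measure_Diff')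
    also have "\<dots> \<le> prob ({0..b} \<times> {0..d})"
      using that by (intro finite_measure_mono) auto
    finally show ?thesis using C that by simp
  qed
  then show "copula C"
    unfolding copula_def using ground marg by auto
qed

section \<open>Copulas of piecewise isometries\<close>

definition overlap :: "real \<Rightarrow> real \<Rightarrow> real \<Rightarrow> real \<Rightarrow> real" where
  "overlap p q l r = max 0 (min q r - max p l)"

lemma measure_overlap: "measure lborel ({p..<q} \<inter> {l..r}) = overlap p q l r"
proof (cases "r < q")
  case True
  then have "{p..<q} \<inter> {l..r} = {max p l..r}" by auto
  then show ?thesis using True by (auto simp: overlap_def)
next
  case False
  then have "{p..<q} \<inter> {l..r} = {max p l..<q}" by auto
  then show ?thesis using False by (cases "max p l \<le> q") (auto simp: overlap_def max_def)
qed

lemma measure_three_pieces: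
  assumes pq: "0 \<le> p" "p \<le> q" "q \<le> 1" and S: "S \<in> sets borel"
    and eq: "\<And>x. 0 \<le> x \<Longrightarrow> x < 1 \<Longrightarrow> x \<in> S \<longleftrightarrow>
      (if x < p then x \<in> {l1..r1} else if x < q then x \<in> {l2..r2} else x \<in> {l3..r3})"
  shows "measure unif01 S = overlap 0 p l1 r1 + overlap p q l2 r2 + overlap q 1 l3 r3"
proof -
  interpret prob_space unif01 by (rule prob_space_unif01)
  let ?A = "{0..<p} \<inter> {l1..r1}" and ?B = "{p..<q} \<inter> {l2..r2}" and ?D = "{q..<1} \<inter> {l3..r3}"
  have sub: "measure unif01 X = measure lborel X" if "X \<subseteq> {0..1}" "X \<in> sets borel" for X
    using that by (simp add: measure_unif01 Int_absorb2)
  have "AE x in unif01. x \<in> S \<longleftrightarrow> x \<in> ?A \<union> ?B \<union> ?D"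
    using AE_unif01 by eventually_elim (use pq eq in auto)
  then have "prob S = prob (?A \<union> ?B \<union> ?D)"
    using S by (intro finite_measure_eq_AE) auto
  also have "\<dots> = prob ?A + prob ?B + prob ?D"
    using pq by (subst finite_measure_Union, simp, simp, force, subst finite_measure_Union) auto
  also have "\<dots> = measure lborel ?A + measure lborel ?B + measure lborel ?D"
    using pq by (subst (1 2 3) sub) auto
  finally show ?thesis by (simp add: measure_overlap)
qed

text \<open>The law is the image of the uniform distribution under
  \<open>x \<mapsto> (x, f x)\<close>, so integrating against it means integrating along the graph.
  The indicator discards parameters at which \<open>f\<close> may leave the unit interval.\<close>

lemma copula_of_graph:
  assumes f: "f \<in> borel_measurable borel"
    and range: "\<And>x. 0 \<le> x \<Longrightarrow> x < 1 \<Longrightarrow> 0 \<le> f x \<and> f x \<le> 1"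
    and C: "\<And>u v. u \<in> {0..1} \<Longrightarrow> v \<in> {0..1} \<Longrightarrow> measure unif01 ({0..u} \<inter> f -` {0..v}) = C u v"
    and marg: "\<And>u. u \<in> {0..1} \<Longrightarrow> C u 1 = u" "\<And>u. u \<in> {0..1} \<Longrightarrow> C 1 u = u"
  shows "copula C" "kendall_tau C = 4 * (\<integral>x. C x (f x) * indicator {0..<1} x \<partial>unif01) - 1"
proof -
  have [measurable]: "(\<lambda>x. (x, f x)) \<in> borel_measurable borel"
    using f by (simp add: borel_measurable_Pair)
  let ?M = "distr unif01 borel (\<lambda>x. (x, f x))"
  have prob: "prob_space ?M"
    by (intro prob_space.prob_space_distr prob_space_unif01) simp
  have "measure ?M ({0..u} \<times> {0..v}) = C u v" if "u \<in> {0..1}" "v \<in> {0..1}" for u v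
  proof -
    have "(\<lambda>x. (x, f x)) -` ({0..u} \<times> {0..v}) = {0..u} \<inter> f -` {0..v}" by auto
    then show ?thesis
      using C[OF that] by (subst measure_distr) (auto simp: borel_closed closed_Times)
  qed
  note law = copula_of_measure[OF prob _ this marg, simplified]
  show "copula C" by (rule law)
  have "(\<integral>p. copula_ext C p \<partial>?M) = (\<integral>x. copula_ext C (x, f x) \<partial>unif01)"
    by (intro integral_distr) (simp_all add: measurable_copula_ext[OF law(1)])
  also have "\<dots> = (\<integral>x. C x (f x) * indicator {0..<1} x \<partial>unif01)"
  proof (rule integral_cong_AE)
    have ext: "(\<lambda>x. copula_ext C (x, f x)) \<in> borel_measurable borel"
      by (rule measurable_compose[OF _ measurable_copula_ext[OF law(1)]]) simp
    then show "(\<lambda>x. copula_ext C (x, f x)) \<in> borel_measurable unif01" by simp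
    \<comment> \<open>\<open>C\<close> itself may fail to be measurable off the square;
      measurability is inherited from \<open>copula_ext C\<close>.\<close>
    have eq: "C x (f x) * indicator {0..<1} x = copula_ext C (x, f x) * indicator {0..<1} x" for x
      using range[of x] by (auto simp: indicator_def)
    have "(\<lambda>x. copula_ext C (x, f x) * indicator {0..<1} x) \<in> borel_measurable borel"
      using ext by measurable
    then show "(\<lambda>x. C x (f x) * indicator {0..<1} x) \<in> borel_measurable unif01"
      by (simp add: eq)
    show "AE x in unif01. copula_ext C (x, f x) = C x (f x) * indicator {0..<1} x"
      using AE_unif01 by eventually_elim (use range in auto)
  qed
  finally show "kendall_tau C = 4 * (\<integral>x. C x (f x) * indicator {0..<1} x \<partial>unif01) - 1"
    by (simp add: kendall_tau_eq[OF law(2,1)])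
qed

text \<open>The largest copula that vanishes at \<open>(b, m)\<close>, and the smallest copula with value \<open>m\<close> at
  \<open>(m, 1 - m)\<close>. Both are carried by the graph of a piecewise isometry of the unit interval.\<close>

definition upper_copula :: "real \<Rightarrow> real \<Rightarrow> real \<Rightarrow> real \<Rightarrow> real" where
  "upper_copula m b u v = min (min u v) (max 0 (u - b) + max 0 (v - m))"

definition upper_shuffle :: "real \<Rightarrow> real \<Rightarrow> real \<Rightarrow> real" where
  "upper_shuffle m b x = (if x < b then x + m else if x < b + m then x - b else x)"

definition lower_copula :: "real \<Rightarrow> real \<Rightarrow> real \<Rightarrow> real" where
  "lower_copula m u v = max (max 0 (u + v - 1)) (m - max 0 (m - u) - max 0 (1 - m - v))"

definition lower_shuffle :: "real \<Rightarrow> real \<Rightarrow> real" where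
  "lower_shuffle m x = (if x < m then 1 - m - x else if x < 2 * m then 1 + m - x else 1 - x)"

lemma upper_copula_graph:
  assumes m: "0 \<le> m" "m \<le> b" "b + m \<le> 1"
  shows "copula (upper_copula m b)"
    and "kendall_tau (upper_copula m b) =
      4 * (\<integral>x. upper_copula m b x (upper_shuffle m b x) * indicator {0..<1} x \<partial>unif01) - 1"
proof -
  have f [measurable]: "upper_shuffle m b \<in> borel_measurable borel"
    unfolding upper_shuffle_def[abs_def] by measurable
  have meas: "measure unif01 ({0..u} \<inter> upper_shuffle m b -` {0..v}) = upper_copula m b u v"
    if "u \<in> {0..1}" "v \<in> {0..1}" for u v
  proof -
    have "measure unif01 ({0..u} \<inter> upper_shuffle m b -` {0..v}) =
        overlap 0 b 0 (min u (v - m)) + overlap b (b + m) 0 (min u (v + b)) + overlap (b + m) 1 0 (min u v)"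
    proof (rule measure_three_pieces)
      show "{0..u} \<inter> upper_shuffle m b -` {0..v} \<in> sets borel"
        using measurable_sets[OF f, of "{0..v}"] by (intro sets.Int) simp_all
    qed (use m in \<open>auto simp: upper_shuffle_def\<close>)
    also have "\<dots> = upper_copula m b u v"
      using that m unfolding overlap_def upper_copula_def by (auto simp: min_def max_def)
    finally show ?thesis .
  qed
  have range: "0 \<le> upper_shuffle m b x \<and> upper_shuffle m b x \<le> 1" if "0 \<le> x" "x < 1" for x
    using that m by (auto simp: upper_shuffle_def)
  have marg: "upper_copula m b u 1 = u" "upper_copula m b 1 u = u" if "u \<in> {0..1}" for u
    using that m by (auto simp: upper_copula_def min_def max_def)
  show "copula (upper_copula m b)"
    and "kendall_tau (upper_copula m b) =
      4 * (\<integral>x. upper_copula m b x (upper_shuffle m b x) * indicator {0..<1} x \<partial>unif01) - 1"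
    by (rule copula_of_graph[OF f range meas marg]; assumption)+
qed

lemma lower_copula_graph:
  assumes m: "0 \<le> m" "3 * m \<le> 1"
  shows "copula (lower_copula m)"
    and "kendall_tau (lower_copula m) =
      4 * (\<integral>x. lower_copula m x (lower_shuffle m x) * indicator {0..<1} x \<partial>unif01) - 1"
proof -
  have f [measurable]: "lower_shuffle m \<in> borel_measurable borel"
    unfolding lower_shuffle_def[abs_def] by measurable
  have meas: "measure unif01 ({0..u} \<inter> lower_shuffle m -` {0..v}) = lower_copula m u v"
    if "u \<in> {0..1}" "v \<in> {0..1}" for u v
  proof -
    \<comment> \<open>All pieces are decreasing, so the bound \<open>v\<close> on the image becomes
      a lower bound on the argument.\<close>
    have "measure unif01 ({0..u} \<inter> lower_shuffle m -` {0..v}) =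
        overlap 0 m (1 - m - v) u + overlap m (2 * m) (1 + m - v) u + overlap (2 * m) 1 (1 - v) u"
    proof (rule measure_three_pieces)
      show "{0..u} \<inter> lower_shuffle m -` {0..v} \<in> sets borel"
        using measurable_sets[OF f, of "{0..v}"] by (intro sets.Int) simp_all
    qed (use m in \<open>auto simp: lower_shuffle_def\<close>)
    also have "\<dots> = lower_copula m u v"
      using that m unfolding overlap_def lower_copula_def by (auto simp: min_def max_def)
    finally show ?thesis .
  qed
  have range: "0 \<le> lower_shuffle m x \<and> lower_shuffle m x \<le> 1" if "0 \<le> x" "x < 1" for x
    using that m by (auto simp: lower_shuffle_def)
  have marg: "lower_copula m u 1 = u" "lower_copula m 1 u = u" if "u \<in> {0..1}" for u
    using that m by (auto simp: lower_copula_def min_def max_def)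
  show "copula (lower_copula m)"
    and "kendall_tau (lower_copula m) =
      4 * (\<integral>x. lower_copula m x (lower_shuffle m x) * indicator {0..<1} x \<partial>unif01) - 1"
    by (rule copula_of_graph[OF f range meas marg]; assumption)+
qed

text \<open>Along its graph the copula equals \<open>m\<close> over the middle piece and 0 over the
  other two.\<close>

lemma kendall_tau_lower_copula:
  assumes m: "0 \<le> m" "3 * m \<le> 1"
  shows "kendall_tau (lower_copula m) = 4 * m\<^sup>2 - 1"
proof -
  interpret prob_space unif01 by (rule prob_space_unif01)
  have "lower_copula m x (lower_shuffle m x) * indicator {0..<1} x = m * indicator {m..<2 * m} x" for x
    using m by (auto simp: lower_copula_def lower_shuffle_def indicator_def max_def)
  then have "(\<integral>x. lower_copula m x (lower_shuffle m x) * indicator {0..<1} x \<partial>unif01) =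
      m * prob {m..<2 * m}"
    by simp
  also have "prob {m..<2 * m} = m"
  proof -
    have "{m..<2 * m} \<inter> {0..1} = {m..<2 * m}" using m by auto
    then show ?thesis using m by (simp add: measure_unif01)
  qed
  finally show ?thesis
    by (simp add: lower_copula_graph(2)[OF m] power2_eq_square)
qed

text \<open>Along its graph the copula equals \<open>x\<close>, except over the middle piece of
  length \<open>m\<close>, where it is smaller by \<open>2 * m\<close>.\<close>

lemma kendall_tau_upper_copula:
  assumes m: "0 \<le> m" "3 * m \<le> 1"
  shows "kendall_tau (upper_copula m (2 * m)) = 1 - 8 * m\<^sup>2"
proof -
  interpret prob_space unif01 by (rule prob_space_unif01)
  have "upper_copula m (2 * m) x (upper_shuffle m (2 * m) x) * indicator {0..<1} x =
      (x - 2 * m * indicator {2 * m..<3 * m} x) * indicator {0..<1} x" for x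
    using m by (auto simp: upper_copula_def upper_shuffle_def indicator_def max_def min_def)
  then have "(\<integral>x. upper_copula m (2 * m) x (upper_shuffle m (2 * m) x) * indicator {0..<1} x \<partial>unif01) =
      (\<integral>x. (x - 2 * m * indicator {2 * m..<3 * m} x) * indicator {0..<1} x \<partial>unif01)"
    by (intro Bochner_Integration.integral_cong refl)
  also have "\<dots> = (\<integral>x. x - 2 * m * indicator {2 * m..<3 * m} x \<partial>unif01)"
  proof (rule integral_cong_AE)
    show "AE x in unif01. (x - 2 * m * indicator {2 * m..<3 * m} x) * indicator {0..<1} x =
        x - 2 * m * indicator {2 * m..<3 * m} x"
      using AE_unif01 by eventually_elim simp
  qed simp_all
  also have "\<dots> = 1 / 2 - 2 * m * prob {2 * m..<3 * m}"
  proof -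
    have "AE x in unif01. norm x \<le> 1"
      using AE_unif01 by eventually_elim auto
    then have "integrable unif01 (\<lambda>x. x)"
      by (rule integrable_const_bound) simp
    moreover have "integrable unif01 (indicator {2 * m..<3 * m} :: real \<Rightarrow> real)"
      by (intro integrable_real_indicator) (simp_all add: less_top[symmetric])
    ultimately show ?thesis
      by (simp add: integral_unif01_id)
  qed
  also have "prob {2 * m..<3 * m} = m"
  proof -
    have "{2 * m..<3 * m} \<inter> {0..1} = {2 * m..<3 * m}" using m by auto
    then show ?thesis using m by (simp add: measure_unif01)
  qed
  finally show ?thesis
    using upper_copula_graph(2)[of m "2 * m"] m by (simp add: power2_eq_square)
qed

text \<open>The copula lies between \<open>min u v - m\<close> and \<open>min u v\<close>, which
  bounds the asymmetry by \<open>m\<close>. The values at the given points use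
  \<open>3 * m \<le> 1\<close>.\<close>

lemma asymmetric_at_upper_copula:
  assumes "0 \<le> m" "3 * m \<le> 1"
  shows "asymmetric_at m m (2 * m) (upper_copula m (2 * m))"
    "asymmetric_at m m (2 * m) (upper_copula m (1 - m))"
    "asymmetric_at m m (1 - m) (upper_copula m (1 - m))"
proof -
  have "\<bar>upper_copula m b u v - upper_copula m b v u\<bar> \<le> m"
    if "m \<le> b" "u \<in> {0..1}" "v \<in> {0..1}" for b u v
    using that assms by (auto simp: upper_copula_def min_def max_def)
  then show "asymmetric_at m m (2 * m) (upper_copula m (2 * m))"
    "asymmetric_at m m (2 * m) (upper_copula m (1 - m))"
    "asymmetric_at m m (1 - m) (upper_copula m (1 - m))"
    using assms by (auto simp: asymmetric_at_def) (auto simp: upper_copula_def)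
qed

lemma asymmetric_at_lower_copula:
  assumes "0 \<le> m" "3 * m \<le> 1"
  shows "asymmetric_at m m (1 - m) (lower_copula m)"
proof -
  \<comment> \<open>The copula lies in a band of width \<open>m\<close> above a symmetric
    function.\<close>
  have "max 0 (u + v - 1) \<le> lower_copula m u v \<and> lower_copula m u v \<le> max 0 (u + v - 1) + m" for u v
    using assms by (auto simp: lower_copula_def)
  then have "\<bar>lower_copula m u v - lower_copula m v u\<bar> \<le> m" for u v
    by (smt (verit) add.commute)
  moreover have "lower_copula m m (1 - m) = m" "lower_copula m (1 - m) m = 0"
    using assms by (auto simp: lower_copula_def)
  ultimately show ?thesis by (simp add: asymmetric_at_def)
qed

text \<open>The two extremal copulas attain their asymmetry at different points, so a convex combination
  of them may be less asymmetric. The copula \<open>upper_copula m (1 - m)\<close> attains asymmetry \<open>m\<close> at both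
  points and links them.\<close>

lemma kendall_tau_attained:
  assumes m: "m \<in> {0..1/3}" and t: "t \<in> {4 * m\<^sup>2 - 1 .. 1 - 8 * m\<^sup>2}"
  shows "\<exists>C. copula C \<and> asymmetry C = m \<and> kendall_tau C = t"
proof -
  have m': "0 \<le> m" "3 * m \<le> 1" using m by auto
  have cop: "copula (lower_copula m)" "copula (upper_copula m (2 * m))" "copula (upper_copula m (1 - m))"
    using m' by (simp_all add: lower_copula_graph upper_copula_graph)
  show ?thesis
  proof (cases "t \<le> kendall_tau (upper_copula m (1 - m))")
    case True
    show ?thesis
      by (rule asymmetric_at_intermediate[OF cop(1,3) _ True asymmetric_at_lower_copula[OF m']
            asymmetric_at_upper_copula(3)[OF m']])
        (use m' t in \<open>auto simp: kendall_tau_lower_copula\<close>)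
  next
    case False
    then have le: "kendall_tau (upper_copula m (1 - m)) \<le> t" by simp
    show ?thesis
      by (rule asymmetric_at_intermediate[OF cop(3,2) le _ asymmetric_at_upper_copula(2)[OF m']
            asymmetric_at_upper_copula(1)[OF m']])
        (use m' t in \<open>auto simp: kendall_tau_upper_copula\<close>)
  qed
qed

section \<open>Symmetric copulas as the case of asymmetry 0, and the final statement\<close>

lemma asymmetry_zero_iff:
  assumes C: "copula C"
  shows "asymmetry C = 0 \<longleftrightarrow> symmetric_copula C"
proof -
  obtain u v where uv: "u \<in> {0..1}" "v \<in> {0..1}" "asymmetry C = \<bar>C u v - C v u\<bar>"
    and max: "\<forall>u'\<in>{0..1}. \<forall>v'\<in>{0..1}. \<bar>C u' v' - C v' u'\<bar> \<le> \<bar>C u v - C v u\<bar>"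
    using asymmetry_attained[OF C] by blast
  show ?thesis
    using uv max C unfolding symmetric_copula_def by fastforce
qed

theorem theorem12:
  shows "(\<forall>C m. copula C \<and> asymmetry C = m \<longrightarrow>
            kendall_tau C \<in> {4 * m\<^sup>2 - 1 .. 1 - 8 * m\<^sup>2}) \<and>
         (\<forall>m\<in>{0..1/3}. \<forall>t\<in>{4 * m\<^sup>2 - 1 .. 1 - 8 * m\<^sup>2}.
            \<exists>C. copula C \<and> asymmetry C = m \<and> kendall_tau C = t) \<and>
         kendall_tau ` {C. symmetric_copula C} = {-1..1} \<and>
         (\<forall>C. copula C \<and> asymmetry C = 1/3 \<longrightarrow> kendall_tau C \<in> {-5/9 .. 1/9})"
proof (intro conjI)
  show "\<forall>C m. copula C \<and> asymmetry C = m \<longrightarrow>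
      kendall_tau C \<in> {4 * m\<^sup>2 - 1 .. 1 - 8 * m\<^sup>2}"
    using kendall_tau_bounds by auto
  show "\<forall>m\<in>{0..1/3}. \<forall>t\<in>{4 * m\<^sup>2 - 1 .. 1 - 8 * m\<^sup>2}.
      \<exists>C. copula C \<and> asymmetry C = m \<and> kendall_tau C = t"
    using kendall_tau_attained by blast
  show "kendall_tau ` {C. symmetric_copula C} = {-1..1}"
  proof (intro equalityI subsetI)
    fix t assume "t \<in> kendall_tau ` {C. symmetric_copula C}"
    then obtain C where "symmetric_copula C" "t = kendall_tau C" by blast
    then show "t \<in> {-1..1}"
      using kendall_tau_bounds[of C] asymmetry_zero_iff[of C] by (simp add: symmetric_copula_def)
  next
    fix t :: real assume "t \<in> {-1..1}"
    then obtain C where "copula C" "asymmetry C = 0" "kendall_tau C = t"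
      using kendall_tau_attained[of 0 t] by auto
    then show "t \<in> kendall_tau ` {C. symmetric_copula C}"
      using asymmetry_zero_iff by blast
  qed
  show "\<forall>C. copula C \<and> asymmetry C = 1/3 \<longrightarrow> kendall_tau C \<in> {-5/9 .. 1/9}"
  proof (intro allI impI)
    fix C assume "copula C \<and> asymmetry C = 1/3"
    then have C: "copula C" and third: "asymmetry C = 1/3" by auto
    show "kendall_tau C \<in> {-5/9 .. 1/9}"
      using kendall_tau_bounds[OF C] unfolding third by (simp add: power2_eq_square)
  qed
qed

end
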